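(* Let $w\ge3$ be odd. (i) If $p\ge11$ is prime and $r=\lfloor (p+1)/4\rfloor$, then the second coordinate of $U_r^{(r,w)}(q_p)$ is nonzero and $$\frac{\bigl(U_r^{(r,w)}(q_p)\bigr)_1}{\bigl(U_r^{(r,w)}(q_p)\bigr)_2}=E^{(w)}_{(p-1)/2}(q_p).$$ (ii) If $p>w$ is prime, then $$\mathcal E_p^{(w)}\equiv\left(1-2^{1-w}\right)Z(w)_p\pmod{1-q_p}.$$ Consequently, the algebraic limit, i.e. the element $\bigl(\mathcal E_p^{(w)}\bmod(1-q_p)\bigr)_p\in\mathcal A$, is $(1-2^{1-w})Z(w)$. (iii) One has $$\lim_{\substack{N\to\infty\\ N\ \mathrm{odd}}}\mathcal E_N^{(w)}=\left(1-2^{1-w}\right)\zeta(w).$$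
   Context: Put $[n]_q=\frac{1-q^n}{1-q}=1+q+\dots+q^{n-1}$ for $n\ge1$, $[m]_q!=\prod_{j=1}^m[j]_q$, $[0]_q!=1$. For $a\in\mathbb Z$ put $\langle a\rangle_q=[a]_q$ if $a>0$, $\langle 0\rangle_q=0$, and $\langle a\rangle_q=-[-a]_q$ if $a<0$. For odd $w\ge3$ and $m\ge0$ put $$E_m^{(w)}(q)=\sum_{n=1}^m\frac{(-1)^{n-1}q^{2n}}{[n]_q^w},\qquad h_m(q)=\frac{[m]_q!^2\,[2m]_q!}{[2]_q^{3m}}.$$ For $k,m\ge0$ put $$T_m^{(k)}(q)=\frac{\langle2\rangle_q}{\langle 2m-2k-1\rangle_q},$$ $$\rho_m^{(k)}(q)=\frac{\langle m-2k-2\rangle_q\langle 2m+2k+1\rangle_q}{\langle2\rangle_q^2}\left(\langle m\rangle_q\langle m-2k-2\rangle_q+\langle 2k+2\rangle_q^2\right).$$ The pairs $U_m^{(k,w)}(q)\in\mathbb Q(q)^2$ of rational functions are defined for $k,m\ge0$ by $U_m^{(0,w)}(q)=h_m(q)\bigl(E_m^{(w)}(q),1\bigr)$ and $$U_m^{(k+1,w)}(q)=T_m^{(k)}(q)\left(U_{m+1}^{(k,w)}(q)+\rho_{m+1}^{(k)}(q)\,U_m^{(k,w)}(q)\right).$$ Subscripts $1,2$ on a pair denote its first and second coordinate, and $U_m^{(k,w)}(q_p)$ is the value of the rational functions at $q=q_p$. For odd $N\ge5$ put $q_N=e^{2\pi i/N}$ and $\mathcal E_N^{(w)}=E_{(N-1)/2}^{(w)}(q_N)$,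 a complex number. $B_n$ is the $n$-th Bernoulli number. $\mathcal A=\bigl(\prod_p\mathbb Z/p\mathbb Z\bigr)/\bigl(\bigoplus_p\mathbb Z/p\mathbb Z\bigr)$ over all primes $p$, so two families are identified if they agree at all but finitely many primes. For odd $w\ge3$, $Z(w)=\bigl(\frac{B_{p-w}}{w}\bmod p\bigr)_p\in\mathcal A$, and $Z(w)_p=\frac{B_{p-w}}{w}\bmod p$ is its component at a prime $p>w$ (components at $p\le w$ are arbitrary). Congruences modulo $1-q_p$ are taken in the local ring $\mathbb Z[q_p]_{(1-q_p)}$, whose residue field is identified with $\mathbb Z/p\mathbb Z$. *)

theory Defs
  imports
    "HOL-Analysis.Analysis"
    "HOL-Computational_Algebra.Polynomial"
    "HOL-Computational_Algebra.Formal_Power_Series"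
    "HOL-Computational_Algebra.Fraction_Field"
    "HOL-Number_Theory.Residues"
    "HOL-Number_Theory.Modular_Inverse"
    "HOL-Algebra.QuotRing"
begin

section \<open>q-analogues over an arbitrary field\<close>

definition qnum :: "'a::field \<Rightarrow> nat \<Rightarrow> 'a" where
  "qnum q n = (\<Sum>i<n. q ^ i)"

lemma qnum_eq_quotient: "q \<noteq> 1 \<Longrightarrow> qnum q n = (1 - q ^ n) / (1 - q)"
  unfolding qnum_def by (simp add: sum_gp_strict)

definition qfact :: "'a::field \<Rightarrow> nat \<Rightarrow> 'a" where
  "qfact q m = (\<Prod>j=1..m. qnum q j)"

text \<open>The odd extension of \<^const>\<open>qnum\<close> to the integers.\<close>

definition qang :: "'a::field \<Rightarrow> int \<Rightarrow> 'a" where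
  "qang q a = (if a > 0 then qnum q (nat a) else if a = 0 then 0 else - qnum q (nat (- a)))"

definition qE :: "nat \<Rightarrow> nat \<Rightarrow> 'a::field \<Rightarrow> 'a" where
  "qE w m q = (\<Sum>n=1..m. (-1) ^ (n - 1) * q ^ (2 * n) / qnum q n ^ w)"

definition qh :: "nat \<Rightarrow> 'a::field \<Rightarrow> 'a" where
  "qh m q = (qfact q m)\<^sup>2 * qfact q (2 * m) / qnum q 2 ^ (3 * m)"

definition qT :: "nat \<Rightarrow> nat \<Rightarrow> 'a::field \<Rightarrow> 'a" where
  "qT k m q = qang q 2 / qang q (2 * int m - 2 * int k - 1)"

definition qrho :: "nat \<Rightarrow> nat \<Rightarrow> 'a::field \<Rightarrow> 'a" where
  "qrho k m q =
     qang q (int m - 2 * int k - 2) * qang q (2 * int m + 2 * int k + 1) / (qang q 2)\<^sup>2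
       * (qang q (int m) * qang q (int m - 2 * int k - 2) + (qang q (2 * int k + 2))\<^sup>2)"


section \<open>The pairs of rational functions and their values\<close>

type_synonym ratfun = "rat poly fract"

definition qvar :: ratfun where
  "qvar = Fraction_Field.Fract [:0, 1:] 1"

fun U :: "nat \<Rightarrow> nat \<Rightarrow> nat \<Rightarrow> ratfun \<times> ratfun" where
  "U w 0 m = (qh m qvar * qE w m qvar, qh m qvar)"
| "U w (Suc k) m =
     (qT k m qvar * (fst (U w k (Suc m)) + qrho k (Suc m) qvar * fst (U w k m)),
      qT k m qvar * (snd (U w k (Suc m)) + qrho k (Suc m) qvar * snd (U w k m)))"

abbreviation rpoly :: "rat poly \<Rightarrow> complex \<Rightarrow> complex" where
  "rpoly a z \<equiv> poly (map_poly of_rat a) z"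

text \<open>A rational function has the value \<open>v\<close> at \<open>z\<close> if it can be written as a fraction whose
  denominator does not vanish at \<open>z\<close> and whose pointwise quotient at \<open>z\<close> is \<open>v\<close>.\<close>

definition has_value :: "ratfun \<Rightarrow> complex \<Rightarrow> complex \<Rightarrow> bool" where
  "has_value f z v \<longleftrightarrow>
     (\<exists>a b. f = Fraction_Field.Fract a b \<and> rpoly b z \<noteq> 0 \<and> v = rpoly a z / rpoly b z)"

definition regular_at :: "ratfun \<Rightarrow> complex \<Rightarrow> bool" where
  "regular_at f z \<longleftrightarrow> (\<exists>v. has_value f z v)"

text \<open>Meaningful only under \<^const>\<open>regular_at\<close>.\<close>

definition value_at :: "ratfun \<Rightarrow> complex \<Rightarrow> complex" where
  "value_at f z = (THE v. has_value f z v)"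

lemma rpoly_mult: "rpoly (a * b) z = rpoly a z * rpoly b z"
proof -
  have "map_poly (of_rat :: rat \<Rightarrow> complex) (a * b) = map_poly of_rat a * map_poly of_rat b"
    by (rule poly_eqI) (simp add: coeff_map_poly coeff_mult of_rat_sum of_rat_mult)
  then show ?thesis by simp
qed

lemma has_value_unique:
  assumes "has_value f z v" "has_value f z v'"
  shows "v = v'"
proof -
  obtain a b where ab: "f = Fraction_Field.Fract a b" "rpoly b z \<noteq> 0" "v = rpoly a z / rpoly b z"
    using assms(1) unfolding has_value_def by blast
  obtain c d where cd: "f = Fraction_Field.Fract c d" "rpoly d z \<noteq> 0" "v' = rpoly c z / rpoly d z"
    using assms(2) unfolding has_value_def by blast
  have "b \<noteq> 0" "d \<noteq> 0" using ab(2) cd(2) by auto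
  then have "a * d = c * b" using ab(1) cd(1) by (simp add: eq_fract)
  then have "rpoly a z * rpoly d z = rpoly c z * rpoly b z" by (metis rpoly_mult)
  then show ?thesis using ab cd by (simp add: frac_eq_eq)
qed

lemma value_at_eqI: "has_value f z v \<Longrightarrow> value_at f z = v"
  unfolding value_at_def using has_value_unique by (intro the_equality)

definition zroot :: "nat \<Rightarrow> complex" where
  "zroot N = exp (2 * of_real pi * \<i> / of_nat N)"

definition calE :: "nat \<Rightarrow> nat \<Rightarrow> complex" where
  "calE w N = qE w ((N - 1) div 2) (zroot N)"


section \<open>Congruences modulo \<open>1 - z\<close> in the localisation of \<open>\<int>[z]\<close>\<close>

definition int_adjoin :: "complex \<Rightarrow> complex set" where
  "int_adjoin z = range (\<lambda>f :: int poly. poly (map_poly of_int f) z)"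

definition loc_ring :: "complex \<Rightarrow> complex set" where
  "loc_ring z =
     {a / b | a b. a \<in> int_adjoin z \<and> b \<in> int_adjoin z \<and> b \<notin> (\<lambda>x. (1 - z) * x) ` int_adjoin z}"

definition loc_cong :: "complex \<Rightarrow> complex \<Rightarrow> complex \<Rightarrow> bool" where
  "loc_cong z x y \<longleftrightarrow>
     x \<in> loc_ring z \<and> y \<in> loc_ring z \<and> x - y \<in> (\<lambda>u. (1 - z) * u) ` loc_ring z"

text \<open>The image of \<open>x\<close> in the residue field of the local ring at a prime \<open>p\<close>, the latter being
  identified with the integers modulo \<open>p\<close>, represented by \<open>{0..<p}\<close>.\<close>

definition loc_residue :: "nat \<Rightarrow> complex \<Rightarrow> int" where
  "loc_residue p x = (THE c. c \<in> {0..<int p} \<and> loc_cong (zroot p) x (of_int c))"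


section \<open>The ring of families of residues modulo finitely many primes\<close>

definition prime_prod :: "(nat \<Rightarrow> int) ring" where
  "prime_prod =
     \<lparr>carrier = (\<Pi>\<^sub>E p\<in>{p. prime p}. carrier (residue_ring (int p))),
      monoid.mult = (\<lambda>f g. \<lambda>p\<in>{p. prime p}. f p \<otimes>\<^bsub>residue_ring (int p)\<^esub> g p),
      one = (\<lambda>p\<in>{p. prime p}. \<one>\<^bsub>residue_ring (int p)\<^esub>),
      zero = (\<lambda>p\<in>{p. prime p}. \<zero>\<^bsub>residue_ring (int p)\<^esub>),
      add = (\<lambda>f g. \<lambda>p\<in>{p. prime p}. f p \<oplus>\<^bsub>residue_ring (int p)\<^esub> g p)\<rparr>"

definition prime_sum :: "(nat \<Rightarrow> int) set" where
  "prime_sum =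
     {f \<in> carrier prime_prod. finite {p. prime p \<and> f p \<noteq> \<zero>\<^bsub>residue_ring (int p)\<^esub>}}"

definition ringA :: "(nat \<Rightarrow> int) set ring" where
  "ringA = prime_prod Quot prime_sum"

text \<open>The element of \<^const>\<open>ringA\<close> given by integer representatives.\<close>

definition A_class :: "(nat \<Rightarrow> int) \<Rightarrow> (nat \<Rightarrow> int) set" where
  "A_class f = prime_sum +>\<^bsub>prime_prod\<^esub> (\<lambda>p\<in>{p. prime p}. f p mod int p)"

text \<open>Reduction of a rational number modulo \<open>p\<close>, meaningful only if \<open>p\<close> does not divide the
  denominator.\<close>

definition rat_mod :: "nat \<Rightarrow> rat \<Rightarrow> int" where
  "rat_mod p x = (case quotient_of x of (a, b) \<Rightarrow> a * modular_inverse (int p) b mod int p)"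

text \<open>The structure map of \<^const>\<open>ringA\<close> as an algebra over the rational numbers.\<close>

definition A_of_rat :: "rat \<Rightarrow> (nat \<Rightarrow> int) set" where
  "A_of_rat x = A_class (\<lambda>p. rat_mod p x)"

lemma residue_ring_cring: "prime p \<Longrightarrow> cring (residue_ring (int p))"
  by (rule residues.cring) (simp add: residues_def prime_gt_Suc_0_nat)

lemma prime_prod_cring: "cring prime_prod"
proof -
  have c: "cring (residue_ring (int p))" if "prime p" for p :: nat
    using that by (rule residue_ring_cring)
  note r = cring.axioms(1)[OF c]
  note ax = ring.ring_simprules[OF r] cring.cring_simprules(5-)[OF c]
    monoid.r_one[OF ring.is_monoid[OF r]]
  show ?thesis
  proof (rule cringI)
    show "abelian_group prime_prod"
    proof (rule abelian_groupI)
      fix x assume x: "x \<in> carrier prime_prod"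
      let ?y = "\<lambda>p\<in>{p. prime p}. \<ominus>\<^bsub>residue_ring (int p)\<^esub> x p"
      show "\<exists>y\<in>carrier prime_prod. y \<oplus>\<^bsub>prime_prod\<^esub> x = \<zero>\<^bsub>prime_prod\<^esub>"
        using x by (intro bexI[of _ ?y]) (auto simp: prime_prod_def PiE_iff ax intro!: restrict_ext)
    qed (auto simp: prime_prod_def PiE_iff ax extensional_def fun_eq_iff)
    show "comm_monoid prime_prod"
      by (rule comm_monoidI) (auto simp: prime_prod_def PiE_iff ax extensional_def fun_eq_iff)
  qed (auto simp: prime_prod_def PiE_iff ax extensional_def fun_eq_iff)
qed

lemma prime_sum_ideal: "ideal prime_sum prime_prod"
proof -
  interpret R: cring prime_prod by (rule prime_prod_cring)
  have sub: "prime_sum \<subseteq> carrier prime_prod" unfolding prime_sum_def by blast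
  have zero: "\<zero>\<^bsub>prime_prod\<^esub> \<in> prime_sum"
    unfolding prime_sum_def using R.zero_closed by (auto simp: prime_prod_def)
  have add: "f \<oplus>\<^bsub>prime_prod\<^esub> g \<in> prime_sum" if "f \<in> prime_sum" "g \<in> prime_sum" for f g
  proof -
    have "{p. prime p \<and> (f \<oplus>\<^bsub>prime_prod\<^esub> g) p \<noteq> \<zero>\<^bsub>residue_ring (int p)\<^esub>}
        \<subseteq> {p. prime p \<and> f p \<noteq> \<zero>\<^bsub>residue_ring (int p)\<^esub>}
          \<union> {p. prime p \<and> g p \<noteq> \<zero>\<^bsub>residue_ring (int p)\<^esub>}"
      by (auto simp: prime_prod_def residue_ring_def)
    then show ?thesis using that R.add.m_closed unfolding prime_sum_def
      by (auto intro: finite_subset)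
  qed
  have mult: "x \<otimes>\<^bsub>prime_prod\<^esub> f \<in> prime_sum" if "f \<in> prime_sum" "x \<in> carrier prime_prod" for f x
  proof -
    have "{p. prime p \<and> (x \<otimes>\<^bsub>prime_prod\<^esub> f) p \<noteq> \<zero>\<^bsub>residue_ring (int p)\<^esub>}
        \<subseteq> {p. prime p \<and> f p \<noteq> \<zero>\<^bsub>residue_ring (int p)\<^esub>}"
      by (auto simp: prime_prod_def residue_ring_def)
    then show ?thesis using that R.m_closed unfolding prime_sum_def
      by (auto intro: finite_subset)
  qed
  have minus: "\<ominus>\<^bsub>prime_prod\<^esub> f \<in> prime_sum" if "f \<in> prime_sum" for f
    using mult[OF that, of "\<ominus>\<^bsub>prime_prod\<^esub> \<one>\<^bsub>prime_prod\<^esub>"] that sub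
    by (metis R.add.inv_closed R.l_minus R.l_one R.one_closed subsetD)
  show ?thesis
  proof (rule idealI)
    show "ring prime_prod" by (rule R.ring_axioms)
    show "subgroup prime_sum (add_monoid prime_prod)"
      using sub zero add minus by (intro R.add.subgroupI) (auto simp: a_inv_def)
    show "x \<otimes>\<^bsub>prime_prod\<^esub> f \<in> prime_sum" "f \<otimes>\<^bsub>prime_prod\<^esub> x \<in> prime_sum"
      if "f \<in> prime_sum" "x \<in> carrier prime_prod" for f x
      using mult[OF that] that sub R.m_comm by (auto simp: subset_iff)
  qed
qed

lemma A_class_eq_iff:
  "A_class f = A_class g \<longleftrightarrow> finite {p. prime p \<and> \<not> [f p = g p] (mod int p)}"
proof -
  interpret I: ideal prime_sum prime_prod by (rule prime_sum_ideal)
  let ?r = "\<lambda>f::nat \<Rightarrow> int. \<lambda>p\<in>{p. prime p}. f p mod int p"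
  have car: "?r f \<in> carrier prime_prod" for f
    by (auto simp: prime_prod_def residue_ring_def prime_gt_0_nat)
  have diff: "?r f \<ominus>\<^bsub>prime_prod\<^esub> ?r g = ?r (\<lambda>p. f p - g p)"
  proof -
    have eq: "?r f = ?r (\<lambda>p. f p - g p) \<oplus>\<^bsub>prime_prod\<^esub> ?r g"
      by (auto simp: prime_prod_def residue_ring_def fun_eq_iff mod_simps)
    then show ?thesis
      by (metis a_minus_def I.add.inv_solve_right car)
  qed
  have "A_class f = A_class g \<longleftrightarrow> ?r f \<ominus>\<^bsub>prime_prod\<^esub> ?r g \<in> prime_sum"
    unfolding A_class_def using I.quotient_eq_iff_same_a_r_cos[OF I.ideal_axioms car car] by simp
  also have "\<dots> \<longleftrightarrow> finite {p. prime p \<and> (f p - g p) mod int p \<noteq> 0}"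
    unfolding diff prime_sum_def using car[of "\<lambda>p. f p - g p"]
    by (simp add: residue_ring_def cong: conj_cong)
  finally show ?thesis by (simp add: cong_iff_dvd_diff mod_eq_0_iff_dvd)
qed

section \<open>Bernoulli numbers, the elements \<open>Z(w)\<close> and zeta values\<close>

definition bernoulli :: "nat \<Rightarrow> rat" where
  "bernoulli n = fact n * fps_nth (fps_X / (fps_exp 1 - 1)) n"

text \<open>The components of \<open>Z(w)\<close> at primes \<open>p \<le> w\<close> are irrelevant and set to \<open>0\<close>.\<close>

definition Zcomp :: "nat \<Rightarrow> nat \<Rightarrow> int" where
  "Zcomp w p = (if p > w then rat_mod p (bernoulli (p - w) / of_nat w) else 0)"

definition Zw :: "nat \<Rightarrow> (nat \<Rightarrow> int) set" where
  "Zw w = A_class (Zcomp w)"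

definition zeta_nat :: "nat \<Rightarrow> real" where
  "zeta_nat w = (\<Sum>n. 1 / real (Suc n) ^ w)"

end

theory Submission
  imports Defs
begin

text \<open>
  (i) At \<open>q\<^sub>p\<close> the factor \<open>\<langle>2m + 2k + 3\<rangle>\<close> of \<open>\<rho>\<^bsub>m+1\<^esub>\<^bsup>(k)\<^esup>\<close> vanishes when \<open>m + k + 1 = (p - 1)/2\<close>. Hence along
  the antidiagonal \<open>m + k = (p - 1)/2\<close> every pair is a nonzero multiple of \<open>(E\<^bsub>(p-1)/2\<^esub>, 1)\<close>. If
  \<open>p = 4r + 1\<close>, then \<open>U\<^sub>r\<^bsup>(r)\<^esup>\<close> lies on it. If \<open>p = 4r - 1\<close>, it lies on the next antidiagonal, which
  starts with \<open>h\<^bsub>2r\<^esub>(q\<^sub>p) = 0\<close> and so also consists of multiples of that vector; the multiplier at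
  \<open>U\<^sub>r\<^bsup>(r)\<^esup>\<close>, computed modulo \<open>1 - q\<^sub>p\<close>, is a unit times \<open>21\<close>, so it does not vanish for \<open>p \<ge> 11\<close>.

  (ii) Modulo \<open>1 - q\<^sub>p\<close> the sum becomes \<open>\<Sum> (-1)\<^bsup>n-1\<^esup> n\<^bsup>p-1-w\<^esup>\<close> over \<open>n < p/2\<close>, which is half of the sum over
  \<open>n < p\<close>; the latter is read off the generating function \<open>(1 + e\<^bsup>pt\<^esup>) / (1 + e\<^bsup>t\<^esup>)\<close>.

  (iii) Dominated convergence, since \<open>\<bar>[n]\<bar> \<ge> n/2\<close> at \<open>q\<^sub>N\<close> for \<open>n \<le> N/2\<close>.
\<close>

section \<open>Reduction modulo \<open>1 - z\<close> for a root of unity of odd prime order\<close>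

text \<open>A form of Nakayama's lemma, proved by eliminating one generator at a time. The
  multipliers \<open>s\<close> congruent to 1 play the part of units: moving the \<open>e n\<close>
  summand to the left changes its coefficient only by a multiple of \<open>p\<close>, and products
  of such multipliers are again congruent to 1.\<close>

lemma nakayama_vanishing:
  fixes e :: "nat \<Rightarrow> complex" and p :: int
  assumes "\<And>i. i < n \<Longrightarrow> \<exists>s a. [s = 1] (mod p) \<and>
             of_int s * e i = of_int p * (\<Sum>j<n. of_int (a j) * e j)"
  shows "\<exists>s. [s = 1] (mod p) \<and> (\<forall>i<n. of_int s * e i = 0)"
  using assms
proof (induction n)
  case 0
  then show ?case by (intro exI[of _ 1]) auto
next
  case (Suc n)
  obtain s a where s: "[s = 1] (mod p)"
    and sa: "of_int s * e n = of_int p * (\<Sum>j<Suc n. of_int (a j) * e j)"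
    using Suc.prems[of n] by blast
  define t where "t = s - p * a n"
  have t: "[t = 1] (mod p)"
    using cong_diff[OF s, of "p * a n" 0] by (simp add: t_def cong_0_iff)
  have tn: "of_int t * e n = of_int p * (\<Sum>j<n. of_int (a j) * e j)"
    using sa by (simp add: t_def algebra_simps)
  have "\<exists>s a. [s = 1] (mod p) \<and> of_int s * e i = of_int p * (\<Sum>j<n. of_int (a j) * e j)"
    if "i < n" for i
  proof -
    obtain s' b where s': "[s' = 1] (mod p)"
      and sb: "of_int s' * e i = of_int p * (\<Sum>j<Suc n. of_int (b j) * e j)"
      using Suc.prems[of i] \<open>i < n\<close> by (metis less_SucI)
    have "of_int (t * s') * e i = of_int t * (of_int p * (\<Sum>j<Suc n. of_int (b j) * e j))"
      unfolding sb[symmetric] by simp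
    also have "\<dots> = of_int p * (\<Sum>j<n. of_int t * of_int (b j) * e j)
                     + of_int p * of_int (b n) * (of_int t * e n)"
      by (simp add: algebra_simps sum_distrib_left)
    also have "\<dots> = of_int p * (\<Sum>j<n. of_int (t * b j + p * b n * a j) * e j)"
      unfolding tn by (simp add: algebra_simps sum_distrib_left sum.distrib)
    finally show ?thesis
      using cong_mult[OF t s'] by (metis mult_1)
  qed
  then obtain u where u: "[u = 1] (mod p)" "\<And>i. i < n \<Longrightarrow> of_int u * e i = 0"
    using Suc.IH by blast
  have "of_int (u * t) * e i = 0" if "i < Suc n" for i
  proof (cases "i = n")
    case True
    have "of_int (u * t) * e n = of_int p * (\<Sum>j<n. of_int (a j) * (of_int u * e j))"
      proof -
      have "of_int (u * t) * e n = of_int u * (of_int p * (\<Sum>j<n. of_int (a j) * e j))"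
        unfolding tn[symmetric] by simp
      then show ?thesis by (simp add: algebra_simps sum_distrib_left)
    qed
    then show ?thesis using True u(2) by simp
  next
    case False
    then have "of_int u * e i = 0" using that u(2) by simp
    then show ?thesis by auto
  qed
  then show ?case using cong_mult[OF u(1) t] by (metis mult_1)
qed

section \<open>The ring Z[z] and its generation by powers of z\<close>

abbreviation ipoly :: "int poly \<Rightarrow> complex \<Rightarrow> complex" where
  "ipoly f z \<equiv> poly (map_poly of_int f) z"

lemma ipoly_add: "ipoly (f + g) z = ipoly f z + ipoly g z"
proof -
  have "map_poly (of_int :: int \<Rightarrow> complex) (f + g) = map_poly of_int f + map_poly of_int g"
    by (rule poly_eqI) (simp add: coeff_map_poly)
  then show ?thesis by simp
qed

lemma ipoly_mult: "ipoly (f * g) z = ipoly f z * ipoly g z"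
proof -
  have "map_poly (of_int :: int \<Rightarrow> complex) (f * g) = map_poly of_int f * map_poly of_int g"
    by (rule poly_eqI) (simp add: coeff_map_poly coeff_mult)
  then show ?thesis by simp
qed

lemma ipoly_pCons: "ipoly (pCons c f) z = of_int c + z * ipoly f z"
  by (simp add: map_poly_pCons)

lemma int_adjoin_add: "x \<in> int_adjoin z \<Longrightarrow> y \<in> int_adjoin z \<Longrightarrow> x + y \<in> int_adjoin z"
  unfolding int_adjoin_def by (auto simp: ipoly_add[symmetric])

lemma int_adjoin_mult: "x \<in> int_adjoin z \<Longrightarrow> y \<in> int_adjoin z \<Longrightarrow> x * y \<in> int_adjoin z"
  unfolding int_adjoin_def by (auto simp: ipoly_mult[symmetric])

lemma int_adjoin_of_int [simp]: "of_int c \<in> int_adjoin z"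
  unfolding int_adjoin_def by (rule range_eqI[of _ _ "[:c:]"]) (simp add: map_poly_pCons)

lemma int_adjoin_0 [simp]: "0 \<in> int_adjoin z" and int_adjoin_1 [simp]: "1 \<in> int_adjoin z"
  and int_adjoin_of_nat [simp]: "of_nat n \<in> int_adjoin z"
  using int_adjoin_of_int[of 0 z] int_adjoin_of_int[of 1 z] int_adjoin_of_int[of "int n" z] by simp_all

lemma int_adjoin_self [simp]: "z \<in> int_adjoin z"
  unfolding int_adjoin_def by (rule range_eqI[of _ _ "[:0, 1:]"]) (simp add: map_poly_pCons)

lemma int_adjoin_uminus: "x \<in> int_adjoin z \<Longrightarrow> - x \<in> int_adjoin z"
  using int_adjoin_mult[OF int_adjoin_of_int, of x z "-1"] by simp

lemma int_adjoin_diff: "x \<in> int_adjoin z \<Longrightarrow> y \<in> int_adjoin z \<Longrightarrow> x - y \<in> int_adjoin z"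
  using int_adjoin_add[OF _ int_adjoin_uminus] by fastforce

lemma int_adjoin_power: "x \<in> int_adjoin z \<Longrightarrow> x ^ n \<in> int_adjoin z"
  by (induction n) (auto intro: int_adjoin_mult)

lemma int_adjoin_sum: "(\<And>i. i \<in> A \<Longrightarrow> f i \<in> int_adjoin z) \<Longrightarrow> sum f A \<in> int_adjoin z"
  by (induction A rule: infinite_finite_induct) (auto intro: int_adjoin_add)

lemmas int_adjoin_intros = int_adjoin_add int_adjoin_mult int_adjoin_uminus int_adjoin_diff
  int_adjoin_power int_adjoin_sum

locale prime_root =
  fixes p :: nat and z :: complex
  assumes prime_p: "prime p" and odd_p: "odd p" and z_pow: "z ^ p = 1" and z_ne_1: "z \<noteq> 1"
begin

lemma p_pos [simp]: "p > 0" and p_gt_1: "p > 1"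
  using prime_p by (simp_all add: prime_gt_0_nat prime_gt_Suc_0_nat)

lemma prime_int_p: "prime (int p)"
  using prime_p by simp

lemma int_adjoin_span:
  assumes "x \<in> int_adjoin z"
  shows "\<exists>a :: nat \<Rightarrow> int. x = (\<Sum>j<p. of_int (a j) * z ^ j)"
proof -
  obtain m where m: "p = Suc m" using p_pos gr0_implies_Suc by blast
  have "\<exists>a :: nat \<Rightarrow> int. ipoly f z = (\<Sum>j<p. of_int (a j) * z ^ j)" for f
  proof (induction f)
    case 0
    then show ?case by (intro exI[of _ "\<lambda>_. 0"]) simp
  next
    case (pCons c f)
    then obtain a :: "nat \<Rightarrow> int" where a: "ipoly f z = (\<Sum>j<p. of_int (a j) * z ^ j)" by blast
    \<comment> \<open>Multiplication by \<open>z\<close> shifts the coefficients cyclically: since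
      \<open>z ^ p = 1\<close>, the top one, \<open>a m\<close>, returns to the constant
      term.\<close>
    define b where "b = (\<lambda>j. if j = 0 then c + a m else a (j - 1))"
    have "(\<Sum>j<p. of_int (b j) * z ^ j) = of_int (b 0) + (\<Sum>j<m. of_int (b (Suc j)) * z ^ Suc j)"
      unfolding m by (subst sum.lessThan_Suc_shift) simp
    also have "\<dots> = of_int c + of_int (a m) * z ^ Suc m + z * (\<Sum>j<m. of_int (a j) * z ^ j)"
      using z_pow unfolding m b_def by (simp add: sum_distrib_left mult_ac)
    also have "\<dots> = ipoly (pCons c f) z"
      unfolding ipoly_pCons a m by (simp add: algebra_simps)
    finally show ?case by metis
  qed
  then show ?thesis using assms unfolding int_adjoin_def by auto
qed

text \<open>If \<open>p * u = 1\<close>, then \<open>z ^ i = p * (u * z ^ i)\<close>, and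
  \<open>int_adjoin_span\<close> turns this into a Nakayama system for the powers of
  \<open>z\<close>. The resulting integer congruent to 1 kills \<open>z ^ 0 = 1\<close>, so it is 0,
  which is absurd modulo \<open>p\<close>.\<close>

lemma p_not_unit:
  assumes "u \<in> int_adjoin z"
  shows "of_nat p * u \<noteq> 1"
proof
  assume pu: "of_nat p * u = 1"
  have "\<exists>s a. [s = 1] (mod int p) \<and>
      of_int s * z ^ i = of_int (int p) * (\<Sum>j<p. of_int (a j) * z ^ j)" for i
  proof -
    have "u * z ^ i \<in> int_adjoin z" using assms by (intro int_adjoin_intros) auto
    then obtain a :: "nat \<Rightarrow> int" where "u * z ^ i = (\<Sum>j<p. of_int (a j) * z ^ j)"
      using int_adjoin_span by blast
    then have "of_int 1 * z ^ i = of_int (int p) * (\<Sum>j<p. of_int (a j) * z ^ j)"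
      using pu by (metis mult.assoc of_int_1 of_int_of_nat_eq)
    then show ?thesis using cong_refl by blast
  qed
  then obtain s where s: "[s = 1] (mod int p)" "\<forall>i<p. of_int s * z ^ i = 0"
    using nakayama_vanishing[of p "int p" "\<lambda>i. z ^ i"] by blast
  from s(2) have "s = 0" using p_pos by fastforce
  then show False using s(1) prime_p p_gt_1 by (auto simp: cong_iff_dvd_diff zdvd1_eq)
qed

text \<open>Binomial expansion: the inner coefficients are divisible by \<open>p\<close>, and the
  outer terms 1 and \<open>(- z) ^ p = -1\<close> cancel because \<open>p\<close> is odd.\<close>

lemma frobenius_one_minus: "\<exists>v\<in>int_adjoin z. (1 - z) ^ p = of_nat p * v"
proof -
  let ?t = "\<lambda>k. of_nat (p choose k) * (- z) ^ k"
  have split: "{..p} = insert 0 (insert p {1..<p})" using p_pos by auto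
  have "(1 - z) ^ p = (\<Sum>k\<le>p. ?t k)"
    using binomial_ring[of "- z" 1 p] by simp
  also have "\<dots> = 1 + ((- z) ^ p + (\<Sum>k\<in>{1..<p}. ?t k))"
    unfolding split using p_pos by (subst sum.insert; simp)+
  also have "(- z) ^ p = -1" using odd_p z_pow by simp
  also have "(\<Sum>k\<in>{1..<p}. ?t k) = (\<Sum>k\<in>{1..<p}. of_nat p * (of_nat ((p choose k) div p) * (- z) ^ k))"
  proof (rule sum.cong[OF refl])
    fix k assume "k \<in> {1..<p}"
    then have "p dvd (p choose k)" using prime_p by (intro dvd_choose_prime) auto
    then have "(of_nat (p choose k) :: complex) = of_nat p * of_nat ((p choose k) div p)"
      by (metis dvd_mult_div_cancel of_nat_mult)
    then show "?t k = of_nat p * (of_nat ((p choose k) div p) * (- z) ^ k)" by simp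
  qed
  finally have "(1 - z) ^ p = of_nat p * (\<Sum>k\<in>{1..<p}. of_nat ((p choose k) div p) * (- z) ^ k)"
    by (simp add: sum_distrib_left)
  then show ?thesis by (rule bexI) (intro int_adjoin_intros; simp)
qed

section \<open>The ideal generated by 1 - z and its residue field\<close>

definition maxid :: "complex set" where
  "maxid = (\<lambda>x. (1 - z) * x) ` int_adjoin z"

lemma maxidI: "x \<in> int_adjoin z \<Longrightarrow> (1 - z) * x \<in> maxid"
  by (auto simp: maxid_def)

lemma maxid_add: "x \<in> maxid \<Longrightarrow> y \<in> maxid \<Longrightarrow> x + y \<in> maxid"
  unfolding maxid_def using int_adjoin_add by (force simp: distrib_left[symmetric])

lemma maxid_mult: "x \<in> int_adjoin z \<Longrightarrow> y \<in> maxid \<Longrightarrow> x * y \<in> maxid"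
  unfolding maxid_def using int_adjoin_mult by (force simp: mult.left_commute)

lemma maxid_uminus: "x \<in> maxid \<Longrightarrow> - x \<in> maxid"
  using maxid_mult[of "-1"] int_adjoin_uminus[OF int_adjoin_1] by simp

text \<open>The powers of \<open>z\<close> sum to 0, so \<open>p\<close> is the sum of the
  \<open>1 - z ^ i\<close>, each a multiple of \<open>1 - z\<close>.\<close>

lemma p_in_maxid: "of_nat p \<in> maxid"
proof -
  have "(1 - z) * (\<Sum>i<p. z ^ i) = 0" using z_pow by (simp add: sum_gp_strict)
  then have z0: "(\<Sum>i<p. z ^ i) = 0" using z_ne_1 by simp
  have "of_nat p = (\<Sum>i<p. 1 - z ^ i)" by (simp add: sum_subtractf z0)
  also have "\<dots> = (1 - z) * (\<Sum>i<p. \<Sum>j<i. z ^ j)"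
    by (simp add: sum_distrib_left one_diff_power_eq)
  also have "\<dots> \<in> maxid" by (intro maxidI int_adjoin_intros) auto
  finally show ?thesis .
qed

text \<open>If \<open>p\<close> did not divide \<open>c\<close>, then \<open>1 - z\<close> would be a unit, and so would \<open>p\<close>, which
  divides \<open>(1 - z) ^ p\<close>.\<close>

lemma of_int_in_maxid_iff: "of_int c \<in> maxid \<longleftrightarrow> int p dvd c"
proof
  assume "int p dvd c"
  then obtain k where "c = int p * k" by blast
  then show "of_int c \<in> maxid"
    using maxid_mult[OF int_adjoin_of_int p_in_maxid, of k] by (simp add: mult.commute)
next
  assume c: "of_int c \<in> maxid"
  show "int p dvd c"
  proof (rule ccontr)
    assume "\<not> int p dvd c"
    then have "coprime (int p) c" using prime_p by (simp add: prime_imp_coprime)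
    then obtain a b where "a * int p + b * c = 1" by (metis bezout_int coprime_iff_gcd_eq_1)
    then have "of_int a * of_nat p + of_int b * of_int c = (1 :: complex)"
      by (metis of_int_1 of_int_add of_int_mult of_int_of_nat_eq)
    then have "1 \<in> maxid"
      using maxid_add[OF maxid_mult[OF int_adjoin_of_int p_in_maxid] maxid_mult[OF int_adjoin_of_int c]]
      by metis
    then obtain x where x: "x \<in> int_adjoin z" "(1 - z) * x = 1" by (auto simp: maxid_def)
    obtain v where v: "v \<in> int_adjoin z" "(1 - z) ^ p = of_nat p * v"
      using frobenius_one_minus by blast
    have "of_nat p * (v * x ^ p) = ((1 - z) * x) ^ p" by (simp add: power_mult_distrib v(2))
    also have "\<dots> = 1" using x(2) by simp
    finally show False using p_not_unit[of "v * x ^ p"] v(1) x(1) by (metis int_adjoin_mult int_adjoin_power)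
  qed
qed

text \<open>The value f(z) is congruent to the integer f(1), because x - 1 divides f - f(1).
  Together with \<open>of_int_in_maxid_iff\<close> this identifies the residue field with
  Z/p.\<close>

lemma int_adjoin_reduce:
  assumes "x \<in> int_adjoin z"
  shows "\<exists>c. x - of_int c \<in> maxid"
proof -
  have "\<exists>c. ipoly f z - of_int c \<in> maxid" for f
  proof (cases f)
    case (pCons c g)
    have eq: "ipoly f z - of_int (poly f 1) = - ((1 - z) * ipoly h z)"
      if "f = [:poly f 1:] + [:-1, 1:] * h" for h
    proof -
      have "ipoly f z = ipoly [:poly f 1:] z + ipoly [:-1, 1:] z * ipoly h z"
        using that by (metis ipoly_add ipoly_mult)
      then show ?thesis by (simp add: map_poly_pCons algebra_simps)
    qed
    have "poly (f - [:poly f 1:]) 1 = 0" by simp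
    then obtain h where "f - [:poly f 1:] = [:-1, 1:] * h"
      using poly_eq_0_iff_dvd[of "f - [:poly f 1:]" 1] by (auto elim!: dvdE)
    then have "f = [:poly f 1:] + [:-1, 1:] * h" by (metis diff_add_cancel add.commute)
    then show ?thesis using eq maxid_uminus[OF maxidI] 
      by (metis int_adjoin_def rangeI)
  qed
  then show ?thesis using assms unfolding int_adjoin_def by auto
qed

lemma maxid_prime:
  assumes "x \<in> int_adjoin z" "y \<in> int_adjoin z" "x * y \<in> maxid"
  shows "x \<in> maxid \<or> y \<in> maxid"
proof -
  obtain c d where c: "x - of_int c \<in> maxid" and d: "y - of_int d \<in> maxid"
    using assms(1,2) int_adjoin_reduce by metis
  have "of_int (c * d) = x * y + - (y * (x - of_int c)) + - (of_int c * (y - of_int d))"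
    by (simp add: algebra_simps)
  also have "\<dots> \<in> maxid"
    by (intro maxid_add maxid_uminus maxid_mult c d assms int_adjoin_of_int)
  finally have "int p dvd c * d" by (simp only: of_int_in_maxid_iff)
  then have "int p dvd c \<or> int p dvd d" using prime_p by (simp add: prime_dvd_mult_iff)
  then show ?thesis
    using maxid_add[OF c] maxid_add[OF d] by (metis diff_add_cancel of_int_in_maxid_iff)
qed

section \<open>The local ring and the residues of its elements\<close>

lemma loc_ringI: "a \<in> int_adjoin z \<Longrightarrow> b \<in> int_adjoin z \<Longrightarrow> b \<notin> maxid \<Longrightarrow> a / b \<in> loc_ring z"
  unfolding loc_ring_def maxid_def by blast

lemma loc_ringE:
  assumes "x \<in> loc_ring z"
  obtains a b where "x = a / b" "a \<in> int_adjoin z" "b \<in> int_adjoin z" "b \<notin> maxid" "b \<noteq> 0"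
proof -
  have "0 \<in> maxid" using maxidI[of 0] by simp
  then show ?thesis using assms that unfolding loc_ring_def maxid_def by blast
qed

lemma one_notin_maxid: "1 \<notin> maxid"
  using of_int_in_maxid_iff[of 1] p_gt_1 by (auto simp: zdvd1_eq)

lemma int_adjoin_loc_ring: "x \<in> int_adjoin z \<Longrightarrow> x \<in> loc_ring z"
  using loc_ringI[of x 1] one_notin_maxid by simp

lemma loc_ring_of_int [simp]: "of_int c \<in> loc_ring z"
  by (simp add: int_adjoin_loc_ring)

lemma loc_ring_add: assumes "x \<in> loc_ring z" "y \<in> loc_ring z" shows "x + y \<in> loc_ring z"
proof -
  obtain a b where x: "x = a / b" "a \<in> int_adjoin z" "b \<in> int_adjoin z" "b \<notin> maxid" "b \<noteq> 0"
    using assms(1) by (rule loc_ringE)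
  obtain c d where y: "y = c / d" "c \<in> int_adjoin z" "d \<in> int_adjoin z" "d \<notin> maxid" "d \<noteq> 0"
    using assms(2) by (rule loc_ringE)
  have "x + y = (a * d + c * b) / (b * d)" using x y by (simp add: field_simps)
  then show ?thesis using x y maxid_prime by (auto intro!: loc_ringI int_adjoin_intros)
qed

lemma loc_ring_mult: assumes "x \<in> loc_ring z" "y \<in> loc_ring z" shows "x * y \<in> loc_ring z"
proof -
  obtain a b where x: "x = a / b" "a \<in> int_adjoin z" "b \<in> int_adjoin z" "b \<notin> maxid" "b \<noteq> 0"
    using assms(1) by (rule loc_ringE)
  obtain c d where y: "y = c / d" "c \<in> int_adjoin z" "d \<in> int_adjoin z" "d \<notin> maxid" "d \<noteq> 0"
    using assms(2) by (rule loc_ringE)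
  have "x * y = (a * c) / (b * d)" using x y by (simp add: field_simps)
  then show ?thesis using x y maxid_prime by (auto intro!: loc_ringI int_adjoin_intros)
qed

text \<open>A relation rather than a map to Z/p: any integer representing the residue is allowed, so
  residues can be computed term by term in integer arithmetic.\<close>

definition reduces_to :: "complex \<Rightarrow> int \<Rightarrow> bool" where
  "reduces_to x c \<longleftrightarrow> loc_cong z x (of_int c)"

lemma reduces_to_iff:
  "reduces_to x c \<longleftrightarrow> (\<exists>u\<in>loc_ring z. x = of_int c + (1 - z) * u)"
proof
  assume "\<exists>u\<in>loc_ring z. x = of_int c + (1 - z) * u"
  moreover have "1 - z \<in> loc_ring z" by (intro int_adjoin_loc_ring int_adjoin_intros) auto
  ultimately show "reduces_to x c"
    unfolding loc_cong_def reduces_to_def using loc_ring_add loc_ring_mult loc_ring_of_int by fastforce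
next
  assume "reduces_to x c"
  then obtain u where "u \<in> loc_ring z" "x - of_int c = (1 - z) * u"
    unfolding reduces_to_def loc_cong_def by auto
  then show "\<exists>u\<in>loc_ring z. x = of_int c + (1 - z) * u" by (metis add.commute diff_add_cancel)
qed

lemma reduces_to_add: "reduces_to x c \<Longrightarrow> reduces_to y d \<Longrightarrow> reduces_to (x + y) (c + d)"
  unfolding reduces_to_iff
proof (elim bexE)
  fix u v assume uv: "u \<in> loc_ring z" "v \<in> loc_ring z"
    and xy: "x = of_int c + (1 - z) * u" "y = of_int d + (1 - z) * v"
  have "x + y = of_int (c + d) + (1 - z) * (u + v)" unfolding xy by (simp add: algebra_simps)
  then show "\<exists>u\<in>loc_ring z. x + y = of_int (c + d) + (1 - z) * u" using loc_ring_add[OF uv] by blast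
qed

lemma reduces_to_mult: "reduces_to x c \<Longrightarrow> reduces_to y d \<Longrightarrow> reduces_to (x * y) (c * d)"
  unfolding reduces_to_iff
proof (elim bexE)
  fix u v assume uv: "u \<in> loc_ring z" "v \<in> loc_ring z"
    and xy: "x = of_int c + (1 - z) * u" "y = of_int d + (1 - z) * v"
  have z: "1 - z \<in> loc_ring z" by (intro int_adjoin_loc_ring int_adjoin_intros) auto
  have "x * y = of_int (c * d) + (1 - z) * (of_int c * v + of_int d * u + (1 - z) * (u * v))"
    unfolding xy by (simp add: algebra_simps)
  moreover have "of_int c * v + of_int d * u + (1 - z) * (u * v) \<in> loc_ring z"
    by (intro loc_ring_add loc_ring_mult uv z loc_ring_of_int)
  ultimately show "\<exists>u\<in>loc_ring z. x * y = of_int (c * d) + (1 - z) * u" by blast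
qed

text \<open>Clearing the denominator, which lies outside \<open>maxid\<close>, brings a congruence
  of integers in the local ring back to Z[z]. This is what makes residues unique modulo
  \<open>p\<close>.\<close>

lemma reduces_to_of_int_iff: "reduces_to (of_int a) c \<longleftrightarrow> [a = c] (mod int p)"
proof
  assume "reduces_to (of_int a) c"
  then obtain u where u: "u \<in> loc_ring z" "of_int a = of_int c + (1 - z) * u"
    unfolding reduces_to_iff by blast
  obtain x y where xy: "u = x / y" "x \<in> int_adjoin z" "y \<in> int_adjoin z" "y \<notin> maxid" "y \<noteq> 0"
    using u(1) by (rule loc_ringE)
  have "of_int (a - c) * y = (1 - z) * x" using u(2) xy by simp
  then have "of_int (a - c) * y \<in> maxid" using maxidI[OF xy(2)] by simp
  then have "of_int (a - c) \<in> maxid" using maxid_prime xy(3,4) int_adjoin_of_int by blast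
  then show "[a = c] (mod int p)" by (simp only: of_int_in_maxid_iff cong_iff_dvd_diff)
next
  assume "[a = c] (mod int p)"
  then have "of_int (a - c) \<in> maxid" by (simp only: of_int_in_maxid_iff cong_iff_dvd_diff)
  then obtain x where "x \<in> int_adjoin z" "of_int (a - c) = (1 - z) * x" unfolding maxid_def by blast
  then show "reduces_to (of_int a) c"
    unfolding reduces_to_iff by (intro bexI[of _ x]) (auto simp: algebra_simps int_adjoin_loc_ring)
qed

lemma loc_cong_trans: "loc_cong z x y \<Longrightarrow> loc_cong z y v \<Longrightarrow> loc_cong z x v"
proof -
  assume a: "loc_cong z x y" "loc_cong z y v"
  obtain u t where ut: "u \<in> loc_ring z" "t \<in> loc_ring z" "x - y = (1 - z) * u" "y - v = (1 - z) * t"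
    using a unfolding loc_cong_def by auto
  have "x - v = (x - y) + (y - v)" by simp
  then have "x - v = (1 - z) * (u + t)" "u + t \<in> loc_ring z"
    using ut by (auto simp: distrib_left intro: loc_ring_add)
  then show ?thesis using a unfolding loc_cong_def by blast
qed

lemma loc_cong_sym: "loc_cong z x y \<Longrightarrow> loc_cong z y x"
proof -
  assume a: "loc_cong z x y"
  obtain u where u: "u \<in> loc_ring z" "x - y = (1 - z) * u"
    using a unfolding loc_cong_def by auto
  then have "y - x = (1 - z) * (of_int (-1) * u)" by (simp add: algebra_simps)
  then show ?thesis using a loc_ring_mult[OF loc_ring_of_int u(1)] unfolding loc_cong_def by blast
qed

lemma reduces_to_cong: "reduces_to x c \<Longrightarrow> [c = d] (mod int p) \<Longrightarrow> reduces_to x d"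
  using loc_cong_trans reduces_to_of_int_iff unfolding reduces_to_def by blast

lemma reduces_to_unique: "reduces_to x c \<Longrightarrow> reduces_to x d \<Longrightarrow> [c = d] (mod int p)"
  using loc_cong_trans loc_cong_sym reduces_to_of_int_iff unfolding reduces_to_def by blast

lemma reduces_to_of_int [intro]: "reduces_to (of_int c) c"
  by (simp add: reduces_to_of_int_iff)

lemma reduces_to_consts: "reduces_to (numeral n) (numeral n)" "reduces_to 1 1" "reduces_to 0 0"
  "reduces_to (of_nat m) (int m)"
  using reduces_to_of_int[of "numeral n"] reduces_to_of_int[of 1] reduces_to_of_int[of 0]
    reduces_to_of_int[of "int m"] by simp_all

lemma reduces_to_uminus: "reduces_to x c \<Longrightarrow> reduces_to (- x) (- c)"
  using reduces_to_mult[OF reduces_to_of_int, of x c "-1"] by simp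

lemma reduces_to_diff: "reduces_to x c \<Longrightarrow> reduces_to y d \<Longrightarrow> reduces_to (x - y) (c - d)"
  using reduces_to_add[OF _ reduces_to_uminus] by fastforce

lemma reduces_to_power: "reduces_to x c \<Longrightarrow> reduces_to (x ^ n) (c ^ n)"
  by (induction n) (auto intro: reduces_to_mult reduces_to_consts)

lemma reduces_to_sum: "(\<And>i. i \<in> A \<Longrightarrow> reduces_to (f i) (g i)) \<Longrightarrow> reduces_to (sum f A) (sum g A)"
  by (induction A rule: infinite_finite_induct) (auto intro: reduces_to_add reduces_to_consts)

lemma reduces_to_z: "reduces_to z 1"
  unfolding reduces_to_iff using loc_ring_of_int[of "-1"] by (intro bexI[of _ "-1"]) auto

lemma reduces_to_nonzero: "reduces_to x c \<Longrightarrow> \<not> int p dvd c \<Longrightarrow> x \<noteq> 0"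
  using reduces_to_of_int_iff[of 0 c] by (auto simp: cong_iff_dvd_diff)

text \<open>A numerator in \<open>maxid\<close> would make \<open>x\<close> reduce to 0 as well,
  against uniqueness; hence the fraction may be turned over.\<close>

lemma reduces_to_inverse:
  assumes "reduces_to x c" "\<not> int p dvd c"
  shows "1 / x \<in> loc_ring z"
proof -
  have "x \<in> loc_ring z" using assms(1) by (simp add: reduces_to_def loc_cong_def)
  then obtain a b where x: "x = a / b" "a \<in> int_adjoin z" "b \<in> int_adjoin z" "b \<notin> maxid" "b \<noteq> 0"
    by (rule loc_ringE)
  have "a \<notin> maxid"
  proof
    assume "a \<in> maxid"
    then obtain y where y: "y \<in> int_adjoin z" "a = (1 - z) * y" by (auto simp: maxid_def)
    have "reduces_to x 0" unfolding reduces_to_iff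
      using x y by (intro bexI[of _ "y / b"]) (auto intro: loc_ringI)
    then show False using reduces_to_unique[OF assms(1)] assms(2) cong_0_iff by blast
  qed
  then show ?thesis using x loc_ringI by simp
qed

text \<open>The difference \<open>x / y - e\<close> is the product of \<open>x - e * y\<close>,
  which reduces to 0, and the element \<open>1 / y\<close> of the local ring. So a residue of the
  quotient is any solution \<open>e\<close> of a linear congruence.\<close>

lemma reduces_to_divide:
  assumes "reduces_to x c" "reduces_to y d" "\<not> int p dvd d" "[e * d = c] (mod int p)"
  shows "reduces_to (x / y) e"
proof -
  have y0: "y \<noteq> 0" by (rule reduces_to_nonzero[OF assms(2,3)])
  have "reduces_to (x - of_int e * y) (c - e * d)"
    by (intro reduces_to_diff reduces_to_mult reduces_to_of_int assms)
  then have "reduces_to (x - of_int e * y) 0"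
    using assms(4) by (elim reduces_to_cong) (metis cong_diff_iff_cong_0 cong_sym)
  then obtain u where u: "u \<in> loc_ring z" "x - of_int e * y = (1 - z) * u"
    unfolding reduces_to_iff by auto
  then have "x / y = of_int e + (1 - z) * (u * (1 / y))" using y0 by (simp add: field_simps)
  then show ?thesis unfolding reduces_to_iff
    using loc_ring_mult[OF u(1) reduces_to_inverse[OF assms(2,3)]] by blast
qed

lemma reduces_to_divide_ex:
  assumes "reduces_to x c" "reduces_to y d" "\<not> int p dvd d"
  shows "\<exists>e. [e * d = c] (mod int p) \<and> reduces_to (x / y) e"
proof -
  have "coprime d (int p)"
    using assms(3) prime_p by (metis coprime_commute prime_imp_coprime prime_nat_int_transfer)
  then obtain k where "[d * k = 1] (mod int p)" using cong_solve_coprime_int by blast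
  then have "[(c * k) * d = c] (mod int p)"
    using cong_scalar_left[of "d * k" 1 "int p" c] by (simp add: mult_ac)
  then show ?thesis using reduces_to_divide[OF assms] by blast
qed

lemma reduces_to_qnum: "reduces_to (qnum z n) (int n)"
proof -
  have "reduces_to (qnum z n) (\<Sum>i<n. 1 ^ i)"
    unfolding qnum_def by (intro reduces_to_sum reduces_to_power reduces_to_z)
  then show ?thesis by simp
qed

lemma reduces_to_qang: "reduces_to (qang z a) a"
  using reduces_to_qnum[of "nat a"] reduces_to_uminus[OF reduces_to_qnum[of "nat (- a)"]]
  by (auto simp: qang_def reduces_to_consts)

lemma loc_residue_eqI:
  assumes "z = zroot p" "reduces_to x c"
  shows "loc_residue p x = c mod int p"
  unfolding loc_residue_def
proof (rule the_equality)
  show "c mod int p \<in> {0..<int p} \<and> loc_cong (zroot p) x (of_int (c mod int p))"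
    using reduces_to_cong[OF assms(2), of "c mod int p"] p_pos
    unfolding assms(1)[symmetric] by (simp add: reduces_to_def)
next
  fix d assume d: "d \<in> {0..<int p} \<and> loc_cong (zroot p) x (of_int d)"
  then have "reduces_to x d" by (simp add: assms(1) reduces_to_def[unfolded assms(1)])
  then have "[d = c] (mod int p)" using reduces_to_unique assms(2) by blast
  then show "d = c mod int p" using d by (simp add: cong_def)
qed

end

section \<open>The pairs at a root of unity\<close>

lemma rpoly_add: "rpoly (a + b) z = rpoly a z + rpoly b z"
proof -
  have "map_poly (of_rat :: rat \<Rightarrow> complex) (a + b) = map_poly of_rat a + map_poly of_rat b"
    by (rule poly_eqI) (simp add: coeff_map_poly of_rat_add)
  then show ?thesis by simp
qed

lemma has_valueI:
  "f = Fraction_Field.Fract a b \<Longrightarrow> rpoly b z \<noteq> 0 \<Longrightarrow> v = rpoly a z / rpoly b z \<Longrightarrow> has_value f z v"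
  unfolding has_value_def by blast

lemma has_value_add:
  assumes "has_value f z u" "has_value g z v"
  shows "has_value (f + g) z (u + v)"
proof -
  obtain a b where ab: "f = Fraction_Field.Fract a b" "rpoly b z \<noteq> 0" "u = rpoly a z / rpoly b z"
    using assms(1) unfolding has_value_def by blast
  obtain c d where cd: "g = Fraction_Field.Fract c d" "rpoly d z \<noteq> 0" "v = rpoly c z / rpoly d z"
    using assms(2) unfolding has_value_def by blast
  have "b \<noteq> 0" "d \<noteq> 0" using ab(2) cd(2) by auto
  then have "f + g = Fraction_Field.Fract (a * d + c * b) (b * d)" using ab(1) cd(1) by simp
  then show ?thesis
    by (rule has_valueI) (use ab cd in \<open>auto simp: rpoly_add rpoly_mult add_frac_eq\<close>)
qed

lemma has_value_mult:
  assumes "has_value f z u" "has_value g z v"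
  shows "has_value (f * g) z (u * v)"
proof -
  obtain a b where ab: "f = Fraction_Field.Fract a b" "rpoly b z \<noteq> 0" "u = rpoly a z / rpoly b z"
    using assms(1) unfolding has_value_def by blast
  obtain c d where cd: "g = Fraction_Field.Fract c d" "rpoly d z \<noteq> 0" "v = rpoly c z / rpoly d z"
    using assms(2) unfolding has_value_def by blast
  have "f * g = Fraction_Field.Fract (a * c) (b * d)" using ab(1) cd(1) by simp
  then show ?thesis
    by (rule has_valueI) (use ab cd in \<open>auto simp: rpoly_mult\<close>)
qed

lemma has_value_divide:
  assumes "has_value f z u" "has_value g z v" "v \<noteq> 0"
  shows "has_value (f / g) z (u / v)"
proof -
  obtain a b where ab: "f = Fraction_Field.Fract a b" "rpoly b z \<noteq> 0" "u = rpoly a z / rpoly b z"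
    using assms(1) unfolding has_value_def by blast
  obtain c d where cd: "g = Fraction_Field.Fract c d" "rpoly d z \<noteq> 0" "v = rpoly c z / rpoly d z"
    using assms(2) unfolding has_value_def by blast
  have "f / g = Fraction_Field.Fract (a * d) (b * c)" using ab(1) cd(1) by simp
  then show ?thesis
    by (rule has_valueI) (use ab cd assms(3) in \<open>auto simp: rpoly_mult\<close>)
qed

lemma has_value_0: "has_value 0 z 0"
  unfolding has_value_def Zero_fract_def by (intro exI conjI) (auto simp: map_poly_pCons)

lemma has_value_1: "has_value 1 z 1"
  unfolding has_value_def One_fract_def by (intro exI conjI) auto

lemma has_value_qvar: "has_value qvar z z"
  unfolding has_value_def qvar_def by (intro exI conjI) (auto simp: map_poly_pCons)

lemma has_value_uminus: "has_value f z u \<Longrightarrow> has_value (- f) z (- u)"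
proof -
  have "rpoly (-1) z = -1"
    by (simp add: uminus_poly_def[symmetric] one_pCons map_poly_pCons)
  then have "has_value (-1) z (-1)"
    unfolding has_value_def One_fract_def minus_fract by (intro exI conjI) auto
  then show "has_value f z u \<Longrightarrow> has_value (- f) z (- u)"
    using has_value_mult[of "-1" z "-1"] by simp
qed

lemma has_value_power: "has_value f z u \<Longrightarrow> has_value (f ^ n) z (u ^ n)"
  by (induction n) (auto intro: has_value_1 has_value_mult)

lemma has_value_sum:
  "(\<And>i. i \<in> A \<Longrightarrow> has_value (f i) z (g i)) \<Longrightarrow> has_value (sum f A) z (sum g A)"
  by (induction A rule: infinite_finite_induct) (auto intro: has_value_0 has_value_add)

lemma has_value_prod:
  "(\<And>i. i \<in> A \<Longrightarrow> has_value (f i) z (g i)) \<Longrightarrow> has_value (prod f A) z (prod g A)"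
  by (induction A rule: infinite_finite_induct) (auto intro: has_value_1 has_value_mult)

lemmas has_value_intros = has_value_0 has_value_1 has_value_add has_value_mult has_value_divide
  has_value_uminus has_value_power has_value_sum has_value_prod has_value_qvar

lemma has_value_qnum: "has_value (qnum qvar n) z (qnum z n)"
  unfolding qnum_def by (intro has_value_intros)

lemma has_value_qang: "has_value (qang qvar a) z (qang z a)"
  unfolding qang_def by (auto intro!: has_value_intros has_value_qnum)

lemma has_value_qE:
  "(\<And>n. 1 \<le> n \<Longrightarrow> n \<le> m \<Longrightarrow> qnum z n \<noteq> 0) \<Longrightarrow> has_value (qE w m qvar) z (qE w m z)"
  unfolding qE_def by (intro has_value_intros has_value_qnum) auto

lemma has_value_qh: "qnum z 2 \<noteq> 0 \<Longrightarrow> has_value (qh m qvar) z (qh m z)"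
  unfolding qh_def qfact_def by (intro has_value_intros has_value_qnum) auto

lemma qang_2: "qang q 2 = qnum q 2"
  by (simp add: qang_def)

lemma has_value_qrho: "qnum z 2 \<noteq> 0 \<Longrightarrow> has_value (qrho k m qvar) z (qrho k m z)"
  unfolding qrho_def by (intro has_value_intros has_value_qang) (auto simp: qang_2)

lemma has_value_qT:
  "qang z (2 * int m - 2 * int k - 1) \<noteq> 0 \<Longrightarrow> has_value (qT k m qvar) z (qT k m z)"
  unfolding qT_def by (intro has_value_intros has_value_qang)

text \<open>The recursion of \<open>U\<close> run directly on complex numbers. Where a denominator
  vanishes, division by zero yields a meaningless value; \<open>has_value_U\<close> delimits a
  region in which the result is the value of \<open>U\<close>.\<close>

fun Uval :: "complex \<Rightarrow> nat \<Rightarrow> nat \<Rightarrow> nat \<Rightarrow> complex \<times> complex" where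
  "Uval z w 0 m = (qh m z * qE w m z, qh m z)"
| "Uval z w (Suc k) m =
     (qT k m z * (fst (Uval z w k (Suc m)) + qrho k (Suc m) z * fst (Uval z w k m)),
      qT k m z * (snd (Uval z w k (Suc m)) + qrho k (Suc m) z * snd (Uval z w k m)))"

section \<open>The pairs at z along two antidiagonals\<close>

context prime_root
begin

lemma qang_nonzero: "\<not> int p dvd a \<Longrightarrow> qang z a \<noteq> 0"
  using reduces_to_nonzero[OF reduces_to_qang] .

lemma qnum_nonzero: "1 \<le> n \<Longrightarrow> n < p \<Longrightarrow> qnum z n \<noteq> 0"
  using reduces_to_nonzero[OF reduces_to_qnum, of n] by (simp add: nat_dvd_not_less)

lemma qnum_p: "qnum z p = 0"
  using z_pow z_ne_1 by (simp add: qnum_eq_quotient)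

lemma p_ge_3: "p \<ge> 3"
  using odd_p p_gt_1 by (metis One_nat_def Suc_leI even_numeral le_neq_implies_less numeral_2_eq_2 numeral_3_eq_3)

text \<open>Zero is the only multiple of \<open>p\<close> in this range, and it is even. The
  denominators of \<open>qT\<close> have odd arguments.\<close>

lemma odd_not_dvd:
  assumes "odd a" "- int p < a" "a < int p"
  shows "\<not> int p dvd a"
proof
  assume "int p dvd a"
  moreover have "a \<noteq> 0" using assms(1) by auto
  ultimately have "\<bar>int p\<bar> \<le> \<bar>a\<bar>" using dvd_imp_le_int by blast
  then show False using assms(2,3) by linarith
qed

lemma qT_denom_nonzero:
  "k \<le> m \<Longrightarrow> 2 * m < p + 2 * k + 1 \<Longrightarrow> qang z (2 * int m - 2 * int k - 1) \<noteq> 0"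
  using p_gt_1 by (intro qang_nonzero odd_not_dvd) auto

lemma qnum_2_nonzero: "qnum z 2 \<noteq> 0"
  using qnum_nonzero[of 2] p_ge_3 by simp

lemma qT_nonzero: "k \<le> m \<Longrightarrow> 2 * m < p + 2 * k + 1 \<Longrightarrow> qT k m z \<noteq> 0"
  unfolding qT_def qang_2 using qT_denom_nonzero qnum_2_nonzero by auto

text \<open>The region is closed under the recursion, which calls (k, m) and (k, m + 1) for (k + 1,
  m), and it contains (r, r) for \<open>r = (p + 1) div 4\<close>. Inside it the denominators are
  q-integers [n] with 0 < n < p, or have odd arguments between -p and p, so none vanishes.\<close>

lemma has_value_U:
  assumes "k \<le> m" "2 * (m + k) \<le> p + 1"
  shows "has_value (fst (U w k m)) z (fst (Uval z w k m)) \<and>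
         has_value (snd (U w k m)) z (snd (Uval z w k m))"
  using assms
proof (induction k arbitrary: m)
  case 0
  then have "1 \<le> n \<Longrightarrow> n \<le> m \<Longrightarrow> qnum z n \<noteq> 0" for n
    using p_ge_3 by (intro qnum_nonzero) auto
  then show ?case
    using has_value_qh[OF qnum_2_nonzero] has_value_qE has_value_mult by simp
next
  case (Suc k)
  have "has_value (qT k m qvar) z (qT k m z)"
    using Suc.prems by (intro has_value_qT qT_denom_nonzero) auto
  moreover have "has_value (qrho k (Suc m) qvar) z (qrho k (Suc m) z)"
    by (rule has_value_qrho[OF qnum_2_nonzero])
  ultimately show ?case
    using Suc.IH[of m] Suc.IH[of "Suc m"] Suc.prems by (auto intro!: has_value_add has_value_mult)
qed

lemma qrho_eq_0:
  assumes "2 * (m + k) + 3 = p"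
  shows "qrho k (Suc m) z = 0"
proof -
  have "2 * int (Suc m) + 2 * int k + 1 = int p" using assms by simp
  then have "qang z (2 * int (Suc m) + 2 * int k + 1) = 0"
    using qnum_p by (simp add: qang_def)
  then show ?thesis unfolding qrho_def by (simp only: mult_zero_right mult_zero_left div_0)
qed

text \<open>At k = 0 the factor \<open>qh\<close> involves only [n] with n < p; each step then
  multiplies by a nonzero \<open>qT\<close>. The bound \<open>k \<le> m + 1\<close> reaches the
  point (r, r - 1), which \<open>Uval_top\<close> uses when \<open>p = 4 r - 1\<close>.\<close>

lemma Uval_diagonal:
  assumes "k \<le> m + 1" "2 * (m + k) + 1 = p"
  shows "snd (Uval z w k m) \<noteq> 0 \<and>
         fst (Uval z w k m) = snd (Uval z w k m) * qE w ((p - 1) div 2) z"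
  using assms
proof (induction k arbitrary: m)
  case 0
  then have "m = (p - 1) div 2" "2 * m < p" by auto
  moreover have "qh m z \<noteq> 0"
    unfolding qh_def qfact_def using \<open>2 * m < p\<close> qnum_2_nonzero qnum_nonzero by auto
  ultimately show ?case by simp
next
  case (Suc k)
  have "qrho k (Suc m) z = 0" using Suc.prems by (intro qrho_eq_0) auto
  moreover have "qT k m z \<noteq> 0" using Suc.prems by (intro qT_nonzero) auto
  ultimately show ?case using Suc.IH[of "Suc m"] Suc.prems by simp
qed

lemma qh_eq_0:
  assumes "p \<le> 2 * m"
  shows "qh m z = 0"
proof -
  have "qfact z (2 * m) = 0"
    unfolding qfact_def using assms p_ge_3 qnum_p by (intro prod_zero) auto
  then show ?thesis by (simp add: qh_def)
qed

lemma cong_diff_pI: "a - b = int p \<Longrightarrow> [a = b] (mod int p)"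
  by (simp add: cong_iff_dvd_diff)

text \<open>One antidiagonal above the one where the second coordinates are visibly nonzero, the
  quotient \<open>x\<close> of neighbouring second coordinates satisfies a first-order recursion in \<open>k\<close>; modulo
  \<open>1 - z\<close> its solution is the polynomial \<open>- k (2 k + 1) (12 k\<^sup>2 + 1) / 8\<close>.\<close>

lemma Uval_superdiagonal:
  assumes p: "p + 1 = 4 * r" and "k \<le> r" "m + k = 2 * r"
  shows "fst (Uval z w k m) = snd (Uval z w k m) * qE w ((p - 1) div 2) z \<and>
         (\<exists>x c. snd (Uval z w k m) = x * snd (Uval z w k (m - 1)) \<and> reduces_to x c \<and>
            [8 * c = - (int k * (2 * int k + 1) * (12 * (int k)\<^sup>2 + 1))] (mod int p))"
  using assms(2,3)
proof (induction k arbitrary: m)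
  case 0
  \<comment> \<open>Here \<open>2 * m = p + 1\<close>, so \<open>qh\<close> contains the factor [p]
    = 0 and the quotient starts at \<open>x = 0\<close>.\<close>
  then have "qh m z = 0" using p by (intro qh_eq_0) auto
  then show ?case using reduces_to_consts(3)
    by (intro conjI exI[of _ "0::complex"] exI[of _ "0::int"]) auto
next
  case (Suc k)
  have "m > 0" using Suc.prems p p_gt_1 by auto
  then obtain l where m: "m = Suc l" using gr0_implies_Suc by blast
  have kl: "k \<le> l + 1" "l + k + 2 = 2 * r" using Suc.prems m by auto
  define E where "E = qE w ((p - 1) div 2) z"
  define W where "W = snd (Uval z w k m)"
  \<comment> \<open>The pair at (k, m) lies on the antidiagonal of \<open>Uval_diagonal\<close>; the
    second coordinates below are all expressed as multiples of its second coordinate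
    \<open>W\<close>.\<close>
  have diag: "W \<noteq> 0" "fst (Uval z w k m) = W * E"
    using Uval_diagonal[of k m w] Suc.prems p m by (auto simp: E_def W_def)
  obtain x c where IH: "fst (Uval z w k (Suc m)) = snd (Uval z w k (Suc m)) * E"
    and x: "snd (Uval z w k (Suc m)) = x * W" "reduces_to x c"
    and c: "[8 * c = - (int k * (2 * int k + 1) * (12 * (int k)\<^sup>2 + 1))] (mod int p)"
    using Suc.IH[of "Suc m"] Suc.prems by (auto simp: E_def W_def)
  \<comment> \<open>\<open>?A\<close> and \<open>?B\<close> are the arguments in the denominators of
    \<open>qT k l\<close> and \<open>qT k m\<close>, while \<open>?f\<close>, \<open>?g\<close>,
    \<open>?h\<close> come from \<open>qrho k (Suc m)\<close>; \<open>N\<close> is the numerator of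
    the latter and \<open>n\<close> its residue.\<close>
  let ?A = "2 * int l - 2 * int k - 1" and ?B = "2 * int m - 2 * int k - 1"
  let ?f = "int (Suc m) - 2 * int k - 2" and ?g = "2 * int (Suc m) + 2 * int k + 1"
  let ?h = "2 * int k + 2"
  define N where "N = qang z ?f * qang z ?g * (qang z (int (Suc m)) * qang z ?f + (qang z ?h)\<^sup>2)"
  define n where "n = ?f * ?g * (int (Suc m) * ?f + ?h\<^sup>2)"
  have A0: "qang z ?A \<noteq> 0"
    using Suc.prems m p p_gt_1 by (intro qang_nonzero odd_not_dvd) auto
  have B0: "\<not> int p dvd ?B * 2\<^sup>2"
  proof -
    have "\<not> int p dvd ?B" using Suc.prems m p by (intro odd_not_dvd) auto
    moreover have "\<not> int p dvd 2" using p_ge_3 by (intro zdvd_not_zless) auto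
    ultimately show ?thesis
      using prime_dvd_mult_iff[OF prime_int_p] prime_dvd_power[OF prime_int_p] by blast
  qed
  have B1: "qang z ?B \<noteq> 0" using B0 dvd_mult2 by (intro qang_nonzero) blast
  \<comment> \<open>The new quotient is
    \<open>(qT k m z / qT k l z) * (x + qrho k (Suc m) z)\<close>, written as a single fraction:
    \<open>qrho k (Suc l) z\<close> vanishes, so the neighbour at \<open>l\<close> is just
    \<open>qT k l z * W\<close> and \<open>W\<close> cancels.\<close>
  let ?y = "qang z ?A * ((qang z 2)\<^sup>2 * x + N) / (qang z ?B * (qang z 2)\<^sup>2)"
  have "reduces_to N n"
    unfolding N_def n_def by (intro reduces_to_mult reduces_to_add reduces_to_power reduces_to_qang)
  then have "reduces_to (qang z ?A * ((qang z 2)\<^sup>2 * x + N)) (?A * (2\<^sup>2 * c + n))"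
    by (intro reduces_to_mult reduces_to_add reduces_to_power reduces_to_qang x(2))
  moreover have "reduces_to (qang z ?B * (qang z 2)\<^sup>2) (?B * 2\<^sup>2)"
    by (intro reduces_to_mult reduces_to_power reduces_to_qang)
  ultimately have "\<exists>e. [e * (?B * 2\<^sup>2) = ?A * (2\<^sup>2 * c + n)] (mod int p) \<and> reduces_to ?y e"
    by (rule reduces_to_divide_ex[OF _ _ B0])
  then obtain e where e: "[e * (?B * 4) = ?A * (4 * c + n)] (mod int p)" "reduces_to ?y e" by auto
  have snd1: "snd (Uval z w (Suc k) m) = qT k m z * (x + qrho k (Suc m) z) * W"
    using x(1) by (simp add: W_def algebra_simps)
  have "qrho k (Suc l) z = 0" using kl p by (intro qrho_eq_0) auto
  then have snd2: "snd (Uval z w (Suc k) l) = qT k l z * W" by (simp add: W_def m)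
  have rho: "qrho k (Suc m) z = N / (qang z 2)\<^sup>2" by (simp add: qrho_def N_def)
  have "qang z 2 \<noteq> 0" using qnum_2_nonzero by (simp add: qang_2)
  then have y: "qT k m z * (x + qrho k (Suc m) z) = ?y * qT k l z"
    unfolding rho qT_def using A0 B1 by (simp add: field_simps)
  have ind: "snd (Uval z w (Suc k) m) = ?y * snd (Uval z w (Suc k) (m - 1))"
    unfolding snd1 y using snd2 m by (simp only: diff_Suc_1 mult.assoc)
  have fst1: "fst (Uval z w (Suc k) m) = snd (Uval z w (Suc k) m) * E"
    using IH diag(2) by (simp add: W_def algebra_simps)
  define K where "K = int k"
  \<comment> \<open>Since \<open>p = 4 r - 1\<close>, the residues of \<open>2 m\<close> and
    \<open>2 l\<close> depend on \<open>K\<close> alone. In each congruence below the two sides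
    differ by exactly \<open>p\<close>; doubling avoids halves.\<close>
  have r: "int p = 4 * int r - 1" "int m = 2 * int r - K - 1" "int l = 2 * int r - K - 2"
    using p kl Suc.prems unfolding K_def by linarith+
  have cB: "[?B = - 2 * (2 * K + 1)] (mod int p)"
    by (rule cong_diff_pI) (use r in \<open>simp add: K_def\<close>)
  have cA: "[?A = - 4 * (K + 1)] (mod int p)"
    by (rule cong_diff_pI) (use r in \<open>simp add: K_def\<close>)
  have cf: "[2 * ?f = - 3 * (2 * K + 1)] (mod int p)"
    by (rule cong_diff_pI) (use r in \<open>simp add: K_def\<close>)
  have cg: "[?g = 2] (mod int p)"
    by (rule cong_diff_pI) (use r in \<open>simp add: K_def\<close>)
  have cm: "[2 * int (Suc m) = 1 - 2 * K] (mod int p)"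
    by (rule cong_diff_pI) (use r in \<open>simp add: K_def\<close>)
  have n8: "8 * n = (2 * ?f) * ?g * ((2 * int (Suc m)) * (2 * ?f) + 4 * ?h\<^sup>2)"
    by (simp add: n_def algebra_simps power2_eq_square)
  have "[8 * n = (- 3 * (2 * K + 1)) * 2 * ((1 - 2 * K) * (- 3 * (2 * K + 1)) + 4 * ?h\<^sup>2)] (mod int p)"
    unfolding n8 by (intro cong_mult cong_add cf cg cm cong_refl)
  moreover have "(- 3 * (2 * K + 1)) * 2 * ((1 - 2 * K) * (- 3 * (2 * K + 1)) + 4 * ?h\<^sup>2)
      = - 6 * (2 * K + 1) * (28 * K\<^sup>2 + 32 * K + 13)"
    by (simp add: K_def algebra_simps power2_eq_square)
  ultimately have cn: "[8 * n = - 6 * (2 * K + 1) * (28 * K\<^sup>2 + 32 * K + 13)] (mod int p)"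
    by (simp only:)
  let ?R = "(- 4 * (K + 1)) * (4 * (- (K * (2 * K + 1) * (12 * K\<^sup>2 + 1)))
      + (- 6 * (2 * K + 1) * (28 * K\<^sup>2 + 32 * K + 13)))"
  have 1: "[8 * (e * ((- 2 * (2 * K + 1)) * 4)) = 8 * (e * (?B * 4))] (mod int p)"
    by (intro cong_mult cong_refl cong_sym[OF cB])
  have 2: "[8 * (e * (?B * 4)) = 8 * (?A * (4 * c + n))] (mod int p)"
    by (intro cong_mult e cong_refl)
  have "8 * (?A * (4 * c + n)) = ?A * (4 * (8 * c) + 8 * n)" by (simp add: algebra_simps)
  moreover have "[?A * (4 * (8 * c) + 8 * n) = ?R] (mod int p)"
    by (intro cong_mult cong_add cA cn cong_refl c[folded K_def])
  ultimately have 3: "[8 * (?A * (4 * c + n)) = ?R] (mod int p)" by (simp only:)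
  have "int p dvd 8 * (e * ((- 2 * (2 * K + 1)) * 4)) - ?R"
    using cong_trans[OF 1 cong_trans[OF 2 3]] by (simp only: cong_iff_dvd_diff)
  \<comment> \<open>This identity says that the stated quartic solves the recursion; the factors -8
    and \<open>2 * K + 1\<close> are units modulo \<open>p\<close> and are cancelled next.\<close>
  also have "\<dots> = (- 8) * (2 * K + 1) * (8 * e + (K + 1) * (2 * (K + 1) + 1) * (12 * (K + 1)\<^sup>2 + 1))"
    by (simp add: algebra_simps power2_eq_square)
  finally have dvd: "int p dvd (- 8) * (2 * K + 1) * (8 * e + (K + 1) * (2 * (K + 1) + 1) * (12 * (K + 1)\<^sup>2 + 1))" .
  have "\<not> int p dvd 2 * K + 1"
    using Suc.prems p by (intro odd_not_dvd) (auto simp: K_def)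
  moreover have "\<not> int p dvd - 8"
  proof
    assume "int p dvd - 8"
    then have "int p dvd 2 ^ 3" by (simp add: dvd_minus_iff)
    then have "int p dvd 2" by (rule prime_dvd_power[OF prime_int_p])
    then show False using p_ge_3 zdvd_imp_le[of "int p" 2] by simp
  qed
  ultimately have "int p dvd 8 * e + (K + 1) * (2 * (K + 1) + 1) * (12 * (K + 1)\<^sup>2 + 1)"
    using dvd prime_dvd_mult_iff[OF prime_int_p] by blast
  then have "[8 * e = - (int (Suc k) * (2 * int (Suc k) + 1) * (12 * (int (Suc k))\<^sup>2 + 1))] (mod int p)"
    by (simp add: cong_iff_dvd_diff K_def algebra_simps)
  then show ?case using fst1 ind e(2) unfolding E_def by blast
qed

lemma Uval_top:
  assumes "p \<ge> 11" and r: "r = (p + 1) div 4"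
  shows "snd (Uval z w r r) \<noteq> 0 \<and>
         fst (Uval z w r r) = snd (Uval z w r r) * qE w ((p - 1) div 2) z"
proof (cases "4 * r + 1 = p")
  case True
  then show ?thesis using Uval_diagonal[of r r w] by simp
next
  case False
  then have p: "p + 1 = 4 * r" using odd_p r by presburger
  obtain x c where top: "fst (Uval z w r r) = snd (Uval z w r r) * qE w ((p - 1) div 2) z"
    and x: "snd (Uval z w r r) = x * snd (Uval z w r (r - 1))" "reduces_to x c"
    and c: "[8 * c = - (int r * (2 * int r + 1) * (12 * (int r)\<^sup>2 + 1))] (mod int p)"
    using Uval_superdiagonal[OF p, of r r w] by auto
  have diag: "snd (Uval z w r (r - 1)) \<noteq> 0"
    using Uval_diagonal[of r "r - 1" w] p p_gt_1 by auto
  have "\<not> int p dvd c"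
  proof
    assume "int p dvd c"
    define R where "R = int r"
    have pR: "int p = 4 * R - 1" using p unfolding R_def by linarith
    have "int p dvd 8 * c" using \<open>int p dvd c\<close> by simp
    then have "int p dvd - (R * (2 * R + 1) * (12 * R\<^sup>2 + 1))"
      using cong_dvd_iff[OF c] unfolding R_def by blast
    \<comment> \<open>The factor 32 turns the three factors into polynomials in
      \<open>4 * R\<close>, which is congruent to 1, so the product becomes 1 times 3 times
      7.\<close>
    then have "int p dvd 32 * (R * (2 * R + 1) * (12 * R\<^sup>2 + 1))" by simp
    moreover have "32 * (R * (2 * R + 1) * (12 * R\<^sup>2 + 1)) = (4 * R) * (4 * R + 2) * (3 * (4 * R)\<^sup>2 + 4)"
      by (simp add: algebra_simps power2_eq_square)
    moreover have "4 * R = int p + 1" using pR by simp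
    ultimately have "int p dvd (int p + 1) * (int p + 1 + 2) * (3 * (int p + 1)\<^sup>2 + 4)" by metis
    also have "\<dots> = 21 + int p * ((int p + 4) * (3 * (int p + 1)\<^sup>2 + 4) + 3 * (3 * int p + 6))"
      by (simp add: algebra_simps power2_eq_square)
    finally have "int p dvd 21" by (metis dvd_add_left_iff dvd_triv_left)
    then have "int p dvd 3 * 7" by simp
    then have "int p dvd 3 \<or> int p dvd 7"
      using prime_dvd_mult_iff[OF prime_int_p] by blast
    then show False using assms(1) zdvd_imp_le[of "int p" 3] zdvd_imp_le[of "int p" 7] by auto
  qed
  then have "x \<noteq> 0" using x(2) reduces_to_nonzero by blast
  then show ?thesis using x(1) diag top by simp
qed

end

section \<open>Alternating power sums and Bernoulli numbers\<close>

text \<open>The series e^t - 1 has a nonzero linear coefficient, hence divides t, so the quotient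
  defining the Bernoulli numbers is exact.\<close>

lemma bernoulli_fps: "(fps_X / (fps_exp 1 - 1)) * (fps_exp 1 - 1) = (fps_X :: rat fps)"
proof -
  have "fps_nth (fps_exp 1 - 1 :: rat fps) 1 \<noteq> 0" by simp
  then have "subdegree (fps_exp 1 - 1 :: rat fps) \<le> 1" "fps_exp 1 - 1 \<noteq> (0 :: rat fps)"
    by (rule subdegree_leI) (metis \<open>fps_nth (fps_exp 1 - 1 :: rat fps) 1 \<noteq> 0\<close> fps_zero_nth)
  then have "(fps_exp 1 - 1 :: rat fps) dvd fps_X" by (subst fps_dvd_iff) auto
  then show ?thesis by simp
qed

text \<open>The coefficient of t^(n+1) in \<open>bernoulli_fps\<close>, solved for B_n / n!. In this
  normalization the new divisors are factorials up to (n + 1)!, which suits integrality at primes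
  above n + 1.\<close>

lemma bernoulli_rec:
  "bernoulli n / fact n = (if n = 0 then 1 else 0) - (\<Sum>i<n. bernoulli i / fact i / fact (n + 1 - i))"
proof -
  let ?b = "fps_X / (fps_exp 1 - 1) :: rat fps"
  have b: "fps_nth ?b i = bernoulli i / fact i" for i by (simp add: bernoulli_def)
  have split: "(\<Sum>i\<le>Suc n. f i) = (\<Sum>i<n. f i) + f n + f (Suc n)" for f :: "nat \<Rightarrow> rat"
    by (simp add: lessThan_Suc_atMost[symmetric])
  have "fps_nth (?b * (fps_exp 1 - 1)) (Suc n) = (if n = 0 then 1 else 0)"
    unfolding bernoulli_fps by simp
  moreover have "fps_nth (?b * (fps_exp 1 - 1)) (Suc n)
      = (\<Sum>i\<le>Suc n. bernoulli i / fact i * fps_nth (fps_exp 1 - 1) (Suc n - i))"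
    by (simp only: fps_mult_nth b atLeast0AtMost)
  also have "\<dots> = (\<Sum>i<n. bernoulli i / fact i * fps_nth (fps_exp 1 - 1) (Suc n - i)) + bernoulli n / fact n"
    by (subst split) simp
  also have "(\<Sum>i<n. bernoulli i / fact i * fps_nth (fps_exp 1 - 1) (Suc n - i))
      = (\<Sum>i<n. bernoulli i / fact i / fact (n + 1 - i))"
  proof (intro sum.cong refl)
    fix i assume "i \<in> {..<n}"
    then have "fps_nth (fps_exp 1 - 1 :: rat fps) (Suc n - i) = 1 / fact (n + 1 - i)" by simp
    then show "bernoulli i / fact i * fps_nth (fps_exp 1 - 1) (Suc n - i) = bernoulli i / fact i / fact (n + 1 - i)"
      by (simp only: times_divide_eq_right mult_1_right)
  qed
  finally show ?thesis by (simp only: eq_diff_eq add.commute)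
qed

text \<open>With \<open>b = t / (e\<^sup>t - 1)\<close>, the series \<open>b(t) - b(2t)\<close> equals \<open>t / (e\<^sup>t + 1)\<close>, and
  \<open>\<Sum>k<p. (-1)\<^sup>k e\<^sup>k\<^sup>t = (1 + e\<^sup>p\<^sup>t) / (1 + e\<^sup>t)\<close> for odd \<open>p\<close>.\<close>

lemma alternating_power_sum:
  assumes "odd p" "n > 0"
  shows "(\<Sum>k<p. (-1) ^ k * of_nat k ^ (n - 1)) / fact (n - 1)
    = 2 * (1 - 2 ^ n) * (bernoulli n / fact n)
      + (\<Sum>i<n. (1 - 2 ^ i) * (bernoulli i / fact i) * of_nat p ^ (n - i) / fact (n - i))"
proof -
  let ?E = "fps_exp 1 :: rat fps"
  define b where "b = fps_X / (?E - 1)"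
  have b: "fps_nth b i = bernoulli i / fact i" for i by (simp add: bernoulli_def b_def)
  define b2 where "b2 = b oo (fps_const 2 * fps_X)"
  define d where "d = b - b2"
  have E2: "fps_exp 2 = ?E * ?E" using fps_exp_add_mult[of "1::rat" 1] by simp
  have "b2 * (fps_exp 2 - 1) = (b * (?E - 1)) oo (fps_const 2 * fps_X)"
    unfolding b2_def by (simp add: fps_compose_mult_distrib fps_compose_sub_distrib)
  also have "\<dots> = fps_const 2 * fps_X" unfolding b_def bernoulli_fps by simp
  finally have b2: "b2 * ((?E - 1) * (?E + 1)) = fps_const 2 * fps_X"
    unfolding E2 by (simp add: algebra_simps)
  have b1: "b * (?E - 1) = fps_X" unfolding b_def by (rule bernoulli_fps)
  have two: "fps_const 2 = (2 :: rat fps)" by (simp add: numeral_fps_const)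
  have "(d * (?E + 1)) * (?E - 1) = (b * (?E - 1)) * (?E + 1) - b2 * ((?E - 1) * (?E + 1))"
    by (simp add: d_def algebra_simps)
  also have "\<dots> = fps_X * (?E - 1)"
    unfolding b1 b2 two by (simp add: algebra_simps)
  finally have dE: "d * (?E + 1) = fps_X"
    by (metis bernoulli_fps mult_cancel_right mult_zero_right fps_X_neq_zero)
  define A where "A = (\<Sum>k<p. (- ?E) ^ k)"
  have "(1 - (- ?E)) * A = 1 - (- ?E) ^ p"
    unfolding A_def by (rule one_diff_power_eq[symmetric])
  then have AE: "(?E + 1) * A = 1 + fps_exp (of_nat p)"
    using assms(1) by (simp add: fps_exp_power_mult add.commute)
  have "fps_X * A = d * ((?E + 1) * A)" unfolding dE[symmetric] by (simp add: mult.assoc)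
  then have XA: "fps_X * A = d * (1 + fps_exp (of_nat p))" unfolding AE .
  have dn: "fps_nth d i = (1 - 2 ^ i) * (bernoulli i / fact i)" for i
    unfolding d_def b2_def fps_compose_linear by (simp add: b algebra_simps)
  have Ek: "(- ?E) ^ k = fps_const ((-1) ^ k) * fps_exp (of_nat k)" for k
    by (simp add: power_minus[of ?E] fps_exp_power_mult fps_const_power[symmetric]
        flip: fps_const_neg)
  have "fps_nth A (n - 1) = (\<Sum>k<p. (-1) ^ k * of_nat k ^ (n - 1)) / fact (n - 1)"
    unfolding A_def by (simp add: fps_sum_nth Ek sum_divide_distrib)
  moreover have "fps_nth A (n - 1) = fps_nth (fps_X * A) n" using assms(2) by simp
  moreover have "\<dots> = (\<Sum>i\<le>n. fps_nth d i * fps_nth (1 + fps_exp (of_nat p)) (n - i))"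
    unfolding XA by (simp only: fps_mult_nth atLeast0AtMost)
  \<comment> \<open>The term \<open>i = n\<close> carries the constant coefficient 1 + 1 = 2 and
    gives the main Bernoulli term; every other term carries a positive power of
    \<open>p\<close>.\<close>
  moreover have "\<dots> = (\<Sum>i<n. fps_nth d i * fps_nth (1 + fps_exp (of_nat p)) (n - i)) + fps_nth d n * 2"
    by (simp add: lessThan_Suc_atMost[symmetric])
  moreover have "(\<Sum>i<n. fps_nth d i * fps_nth (1 + fps_exp (of_nat p)) (n - i))
      = (\<Sum>i<n. (1 - 2 ^ i) * (bernoulli i / fact i) * of_nat p ^ (n - i) / fact (n - i))"
    by (intro sum.cong) (auto simp: dn)
  ultimately show ?thesis by (simp add: dn)
qed

text \<open>Under n -> p - n the sign flips because \<open>p\<close> is odd, and the power flips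
  sign modulo \<open>p\<close> because \<open>j\<close> is odd; the flips cancel, so the upper half
  of the sum repeats the lower.\<close>

lemma sum_alternating_reflect:
  fixes p j :: nat
  assumes "odd p" "odd j"
  shows "[(\<Sum>n = 1..p - 1. (-1) ^ (n - 1) * int n ^ j)
          = 2 * (\<Sum>n = 1..(p - 1) div 2. (-1) ^ (n - 1) * int n ^ j)] (mod int p)"
proof -
  define f where "f = (\<lambda>n. (-1) ^ (n - 1) * int n ^ j)"
  define h where "h = (p - 1) div 2"
  have p: "p = 2 * h + 1" using assms(1) by (auto simp: h_def elim: oddE)
  have refl: "[f (p - n) = f n] (mod int p)" if "n \<in> {1..h}" for n
  proof -
    have n: "1 \<le> n" "n \<le> h" using that by auto
    have "int (p - n) = int p - int n" using n p by simp
    then have "[int (p - n) = - int n] (mod int p)" by (simp add: cong_iff_dvd_diff)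
    then have "[(-1) ^ (p - n - 1) * int (p - n) ^ j = (-1) ^ (p - n - 1) * (- int n) ^ j] (mod int p)"
      by (intro cong_mult cong_pow cong_refl)
    also have "(-1) ^ (p - n - 1) * (- int n) ^ j = (-1) ^ (p - n - 1 + 1) * int n ^ j"
      using assms(2) by simp
    also have "(-1 :: int) ^ (p - n - 1 + 1) = (-1) ^ (n - 1)"
      using n p by (intro minus_one_power_iff[THEN trans] ) (auto simp: minus_one_power_iff)
    finally show ?thesis by (simp add: f_def)
  qed
  have "{1..p - 1} = {1..h} \<union> {h + 1..2 * h}" using p by auto
  then have "sum f {1..p - 1} = sum f {1..h} + sum f {h + 1..2 * h}"
    by (simp add: sum.union_disjoint)
  also have "sum f {h + 1..2 * h} = (\<Sum>n = 1..h. f (p - n))"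
    by (rule sum.reindex_bij_witness[of _ "\<lambda>n. p - n" "\<lambda>n. p - n"]) (auto simp: p)
  also have "[sum f {1..h} + (\<Sum>n = 1..h. f (p - n)) = sum f {1..h} + sum f {1..h}] (mod int p)"
    by (intro cong_add cong_refl cong_sum refl)
  finally show ?thesis by (simp add: f_def h_def)
qed

section \<open>Bernoulli numbers and the q-sum modulo p\<close>

context prime_root
begin

lemma fermat_int: "\<not> int p dvd a \<Longrightarrow> [a ^ (p - 1) = 1] (mod int p)"
proof -
  assume a: "\<not> int p dvd a"
  define m where "m = nat (a mod int p)"
  have m: "[int m = a] (mod int p)" by (simp add: m_def cong_def)
  then have "\<not> p dvd m" using a cong_dvd_iff by (metis of_nat_dvd_iff)
  then have "[int (m ^ (p - 1)) = int 1] (mod int p)"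
    using fermat_theorem[OF prime_p] by (simp only: cong_int_iff)
  then show ?thesis using cong_pow[OF m, of "p - 1"] by (metis cong_sym cong_trans of_nat_1 of_nat_power)
qed

lemma reduces_to_fact: "reduces_to (of_rat (fact n)) (fact n)"
proof -
  have "(of_rat (fact n) :: complex) = of_nat (fact n)" by (metis of_nat_fact of_rat_of_nat_eq)
  then show ?thesis using reduces_to_consts(4)[of "fact n"] by (simp only: of_nat_fact)
qed

lemma not_dvd_fact: "n < p \<Longrightarrow> \<not> int p dvd fact n"
  using prime_dvd_fact_iff[OF prime_p, of n] by (metis int_dvd_int_iff not_le of_nat_fact)

text \<open>Induction along \<open>bernoulli_rec\<close>: the factorials divided by are at most (n +
  1)!, hence units modulo \<open>p\<close>.\<close>

lemma bernoulli_integral: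
  assumes "n + 1 < p"
  shows "\<exists>c. reduces_to (of_rat (bernoulli n / fact n)) c"
  using assms
proof (induction n rule: less_induct)
  case (less n)
  have "\<exists>c. reduces_to (of_rat (bernoulli i / fact i / fact (n + 1 - i))) c" if i: "i < n" for i
  proof -
    obtain c where c: "reduces_to (of_rat (bernoulli i / fact i)) c"
      using less.IH[OF i] less.prems i by auto
    have "\<not> int p dvd fact (n + 1 - i)" using less.prems by (intro not_dvd_fact) simp
    then show ?thesis
      unfolding of_rat_divide[of _ "fact (n + 1 - i)"]
      using reduces_to_divide_ex[OF c reduces_to_fact] by blast
  qed
  then obtain c where c: "\<And>i. i < n \<Longrightarrow>
      reduces_to (of_rat (bernoulli i / fact i / fact (n + 1 - i))) (c i)" by metis
  have "reduces_to (of_rat (bernoulli n / fact n)) ((if n = 0 then 1 else 0) - (\<Sum>i<n. c i))"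
    unfolding bernoulli_rec[of n] of_rat_diff of_rat_sum
    by (intro reduces_to_diff reduces_to_sum c) (auto intro: reduces_to_consts)
  then show ?case by blast
qed

text \<open>In \<open>alternating_power_sum\<close> every term with \<open>i < n\<close> is
  \<open>p\<close> times something integral at \<open>p\<close>, so only the B_n term survives;
  multiplication by n! clears the factorials.\<close>

lemma alternating_power_sum_reduces:
  assumes "0 < n" "n + 1 < p" "reduces_to (of_rat (bernoulli n)) c"
  shows "[int n * (\<Sum>k<p. (-1) ^ k * int k ^ (n - 1)) = 2 * (1 - 2 ^ n) * c] (mod int p)"
proof -
  define T where "T = (\<Sum>k<p. (-1) ^ k * int k ^ (n - 1))"
  have T: "(of_int T :: rat) = (\<Sum>k<p. (-1) ^ k * of_nat k ^ (n - 1))" by (simp add: T_def)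
  define s where "s = (\<Sum>i<n. (1 - 2 ^ i) * (bernoulli i / fact i) * of_nat p ^ (n - i) / fact (n - i))"
  have "\<exists>c. reduces_to (of_rat (bernoulli i / fact i)) c" if "i < n" for i
    using that assms by (intro bernoulli_integral) auto
  then obtain e where e: "\<And>i. i < n \<Longrightarrow> reduces_to (of_rat (bernoulli i / fact i)) (e i)" by metis
  have "reduces_to (of_rat s) (\<Sum>i<n. 0)"
    unfolding s_def of_rat_sum
  proof (intro reduces_to_sum)
    fix i assume "i \<in> {..<n}"
    then have i: "i < n" by simp
    have "reduces_to ((1 - 2 ^ i) * of_rat (bernoulli i / fact i) * of_nat p ^ (n - i))
        ((1 - 2 ^ i) * e i * int p ^ (n - i))"
      by (intro reduces_to_mult reduces_to_diff reduces_to_power reduces_to_consts e i)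
    then have "reduces_to ((1 - 2 ^ i) * of_rat (bernoulli i / fact i) * of_nat p ^ (n - i) / of_rat (fact (n - i))) 0"
      using i assms by (intro reduces_to_divide[OF _ reduces_to_fact not_dvd_fact]) (auto simp: cong_iff_dvd_diff)
    then show "reduces_to (of_rat ((1 - 2 ^ i) * (bernoulli i / fact i) * of_nat p ^ (n - i) / fact (n - i))) 0"
      by (simp add: of_rat_mult of_rat_divide of_rat_diff of_rat_power)
  qed
  then have s: "reduces_to (of_rat s) 0" by simp
  have "of_int T / fact (n - 1) = 2 * (1 - 2 ^ n) * (bernoulli n / fact n) + s"
    unfolding T s_def using odd_p assms(1) by (rule alternating_power_sum)
  moreover have fact: "(fact n :: rat) = of_nat n * fact (n - 1)" using assms(1) by (simp add: fact_reduce)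
  ultimately have "of_nat n * of_int T = 2 * (1 - 2 ^ n) * bernoulli n + s * fact n"
    using assms(1) by (simp add: field_simps)
  then have "(of_rat (of_nat n * of_int T) :: complex) = of_rat (2 * (1 - 2 ^ n) * bernoulli n + s * fact n)"
    by simp
  then have "(of_int (int n * T) :: complex)
      = 2 * (1 - 2 ^ n) * of_rat (bernoulli n) + of_rat s * of_rat (fact n)"
    by (simp add: of_rat_mult of_rat_add of_rat_diff of_rat_power)
  moreover have "reduces_to (2 * (1 - 2 ^ n) * of_rat (bernoulli n) + of_rat s * of_rat (fact n))
      (2 * (1 - 2 ^ n) * c + 0 * fact n)"
    by (intro reduces_to_add reduces_to_mult reduces_to_diff reduces_to_power reduces_to_consts
        reduces_to_fact assms s)
  ultimately have "reduces_to (of_int (int n * T)) (2 * (1 - 2 ^ n) * c + 0 * fact n)" by metis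
  then show ?thesis unfolding reduces_to_of_int_iff by (simp add: T_def)
qed

text \<open>Links reduction in the local ring with \<open>rat_mod\<close>. As a is congruent to c b,
  a prime \<open>p\<close> dividing the denominator b would also divide a, against lowest
  terms.\<close>

lemma rat_mod_eqI:
  assumes "reduces_to (of_rat x) c"
  shows "[rat_mod p x = c] (mod int p)"
proof -
  obtain a b where ab: "quotient_of x = (a, b)" by (cases "quotient_of x")
  have x: "x = of_int a / of_int b" and b: "b > 0" and co: "coprime a b"
    using ab quotient_of_div quotient_of_denom_pos quotient_of_coprime by auto
  have "of_rat x * of_int b = (of_int a :: complex)"
    using b by (simp add: x of_rat_divide)
  then have "[a = c * b] (mod int p)"
    using reduces_to_mult[OF assms reduces_to_of_int[of b]] by (metis reduces_to_of_int_iff)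
  moreover have "\<not> int p dvd b"
  proof
    assume "int p dvd b"
    then have "int p dvd a" using calculation by (metis cong_dvd_iff dvd_mult)
    then show False using co \<open>int p dvd b\<close> prime_int_p by (metis coprime_common_divisor not_prime_unit)
  qed
  then have "coprime b (int p)"
    using prime_int_p by (metis coprime_commute prime_imp_coprime)
  then have "[b * modular_inverse (int p) b = 1] (mod int p)" by (rule cong_modular_inverse1)
  then have "[c * (b * modular_inverse (int p) b) = c * 1] (mod int p)" by (intro cong_mult cong_refl)
  ultimately have "[a * modular_inverse (int p) b = c] (mod int p)"
    using cong_mult[of a "c * b" "int p" "modular_inverse (int p) b" "modular_inverse (int p) b"]
    by (metis cong_refl cong_trans mult.assoc mult_1_right)
  then show ?thesis by (simp add: rat_mod_def ab)
qed

text \<open>By Fermat, 2^(1-w) is congruent to 2^(p-w).\<close>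

lemma reduces_to_of_rat_two_powi:
  assumes "0 < w" "w < p"
  shows "reduces_to (of_rat (1 - 2 powi (1 - int w))) (1 - 2 ^ (p - w))"
proof -
  have h: "(2 :: rat) powi (1 - int w) = inverse (2 ^ (w - 1))"
    using assms by (simp add: power_int_def nat_diff_distrib power_one_over inverse_eq_divide)
  then have eq: "(of_rat (1 - 2 powi (1 - int w)) :: complex) = (2 ^ (w - 1) - 1) / 2 ^ (w - 1)"
    unfolding h of_rat_diff of_rat_inverse of_rat_power by (simp add: field_simps)
  have two: "\<not> int p dvd 2" using p_gt_1 odd_p zdvd_imp_le[of "int p" 2] by (cases "p = 2") auto
  have "(1 - 2 ^ (p - w)) * 2 ^ (w - 1) = 2 ^ (w - 1) - (2 :: int) ^ (p - 1)"
    using assms by (simp add: algebra_simps flip: power_add)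
  also have "[\<dots> = 2 ^ (w - 1) - 1] (mod int p)"
    by (intro cong_diff cong_refl fermat_int two)
  finally have "[(1 - 2 ^ (p - w)) * 2 ^ (w - 1) = 2 ^ (w - 1) - 1] (mod int p)" .
  moreover have "reduces_to (2 ^ (w - 1)) (2 ^ (w - 1))"
    by (intro reduces_to_power reduces_to_consts)
  moreover have "\<not> int p dvd 2 ^ (w - 1)"
    using two prime_dvd_power[OF prime_int_p] by blast
  ultimately show ?thesis unfolding eq
    by (blast intro: reduces_to_divide reduces_to_diff reduces_to_consts(2))
qed

lemma reduces_to_qE:
  assumes "w < p"
  shows "reduces_to (qE w ((p - 1) div 2) z) (\<Sum>n = 1..(p - 1) div 2. (-1) ^ (n - 1) * int n ^ (p - 1 - w))"
  unfolding qE_def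
proof (intro reduces_to_sum)
  fix n assume n: "n \<in> {1..(p - 1) div 2}"
  then have "\<not> int p dvd int n" using p_gt_1 by (auto simp: nat_dvd_not_less)
  then have "[int n ^ (p - 1) = 1] (mod int p)" and "\<not> int p dvd int n ^ w"
    using fermat_int prime_dvd_power[OF prime_int_p] by blast+
  moreover have "int n ^ (p - 1 - w) * int n ^ w = int n ^ (p - 1)"
    using assms by (simp flip: power_add)
  ultimately have "[(-1) ^ (n - 1) * int n ^ (p - 1 - w) * int n ^ w = (-1) ^ (n - 1) * 1 ^ (2 * n)] (mod int p)"
    by (simp only: mult.assoc power_one) (intro cong_mult cong_refl)
  moreover have "reduces_to ((-1) ^ (n - 1) * z ^ (2 * n)) ((-1) ^ (n - 1) * 1 ^ (2 * n))"
    by (intro reduces_to_mult reduces_to_power reduces_to_z reduces_to_uminus reduces_to_consts)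
  ultimately show "reduces_to ((-1) ^ (n - 1) * z ^ (2 * n) / qnum z n ^ w) ((-1) ^ (n - 1) * int n ^ (p - 1 - w))"
    using \<open>\<not> int p dvd int n ^ w\<close>
    by (intro reduces_to_divide[OF _ reduces_to_power[OF reduces_to_qnum]])
qed

text \<open>Put n = p - w, which is congruent to -w, and let T be the full and S the half
  alternating sum. Modulo \<open>p\<close>, -w T = 2 (1 - 2^n) B_n and -T = 2 S, whence S = (1 -
  2^n) B_n / w.\<close>

lemma qE_reduces_to_Zcomp:
  assumes "odd w" "3 \<le> w" "w < p"
  shows "reduces_to (qE w ((p - 1) div 2) z) ((1 - 2 ^ (p - w)) * Zcomp w p)"
proof -
  define n where "n = p - w"
  have n: "0 < n" "n + 1 < p" "int n = int p - int w" using assms by (auto simp: n_def)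
  obtain c where c: "reduces_to (of_rat (bernoulli n / fact n)) c"
    using bernoulli_integral[OF n(2)] by blast
  have B: "reduces_to (of_rat (bernoulli n)) (c * fact n)"
    using reduces_to_mult[OF c reduces_to_fact[of n]] by (simp flip: of_rat_mult)
  define \<beta> where "\<beta> = c * fact n"
  have w: "\<not> int p dvd int w" using assms by (auto simp: nat_dvd_not_less)
  obtain e where e: "[e * int w = \<beta>] (mod int p)" "reduces_to (of_rat (bernoulli n) / of_nat w) e"
    using reduces_to_divide_ex[OF B reduces_to_consts(4) w] unfolding \<beta>_def by blast
  have "[rat_mod p (bernoulli n / of_nat w) = e] (mod int p)"
    using e(2) by (intro rat_mod_eqI) (simp add: of_rat_divide)
  then have Z: "[Zcomp w p = e] (mod int p)" using assms by (simp add: Zcomp_def n_def)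
  define T where "T = (\<Sum>k<p. (-1) ^ k * int k ^ (n - 1))"
  define S where "S = (\<Sum>k = 1..(p - 1) div 2. (-1) ^ (k - 1) * int k ^ (n - 1))"
  have nw: "n - 1 = p - 1 - w" and "odd (n - 1)" using assms odd_p by (auto simp: n_def)
  \<comment> \<open>The term k = 0 vanishes since the exponent \<open>n - 1\<close> is odd, hence
    positive.\<close>
  have "T = (\<Sum>k = 1..p - 1. (-1) ^ k * int k ^ (n - 1))"
    unfolding T_def using \<open>odd (n - 1)\<close> 
    by (intro sum.mono_neutral_right) (auto simp: Suc_le_eq intro: gr0I elim: oddE)
  also have "\<dots> = (\<Sum>k = 1..p - 1. - ((-1) ^ (k - 1) * int k ^ (n - 1)))"
    by (intro sum.cong refl) (auto simp: power_eq_if)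
  finally have "- T = (\<Sum>k = 1..p - 1. (-1) ^ (k - 1) * int k ^ (n - 1))" by (simp add: sum_negf)
  then have TS: "[- T = 2 * S] (mod int p)"
    unfolding S_def using sum_alternating_reflect[OF odd_p \<open>odd (n - 1)\<close>] by simp
  have "[int n * T = 2 * (1 - 2 ^ n) * \<beta>] (mod int p)"
    unfolding T_def \<beta>_def by (rule alternating_power_sum_reduces[OF n(1,2) B])
  then have "int p dvd (int p - int w) * T - 2 * (1 - 2 ^ n) * \<beta>"
    by (simp add: cong_iff_dvd_diff n(3))
  moreover obtain u where u: "e * int w - \<beta> = int p * u"
    using e(1) by (auto simp: cong_iff_dvd_diff)
  moreover obtain v where v: "- T - 2 * S = int p * v"
    using TS by (auto simp: cong_iff_dvd_diff)
  \<comment> \<open>This combination eliminates \<open>T\<close>; the remaining factor -2 w is a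
    unit modulo \<open>p\<close>.\<close>
  moreover have "(- 2 * int w) * (S - (1 - 2 ^ n) * e)
      = - ((int p - int w) * T - 2 * (1 - 2 ^ n) * \<beta>) + int p * T + int w * (- T - 2 * S)
        + 2 * (1 - 2 ^ n) * (e * int w - \<beta>)"
    by (simp add: algebra_simps)
  ultimately have "int p dvd (- 2 * int w) * (S - (1 - 2 ^ n) * e)"
    by (simp only: dvd_add dvd_minus_iff dvd_triv_left dvd_mult dvd_mult2)
  moreover have "\<not> int p dvd - 2 * int w"
  proof -
    have "\<not> int p dvd 2" using assms zdvd_imp_le[of "int p" 2] by auto
    then show ?thesis using w prime_dvd_mult_iff[OF prime_int_p, of 2 "int w"] by simp
  qed
  ultimately have "int p dvd S - (1 - 2 ^ n) * e"
    using prime_dvd_mult_iff[OF prime_int_p] by blast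
  then have "[S = (1 - 2 ^ n) * e] (mod int p)" by (simp add: cong_iff_dvd_diff)
  moreover have "[(1 - 2 ^ n) * e = (1 - 2 ^ n) * Zcomp w p] (mod int p)"
    by (intro cong_mult cong_refl cong_sym[OF Z])
  ultimately have "[S = (1 - 2 ^ n) * Zcomp w p] (mod int p)" by (rule cong_trans)
  then show ?thesis
    using reduces_to_qE[OF assms(3)] unfolding S_def nw unfolding n_def by (rule reduces_to_cong[rotated])
qed

end

section \<open>The analytic limit\<close>

text \<open>A weak Jordan inequality by half angles: for y = x/2, tan y >= y gives y cos y <= sin y,
  and cos x >= 0 gives cos(y)^2 >= 1/2; the first is then multiplied by cos y.\<close>

lemma sin_ge_half:
  fixes x :: real
  assumes "0 \<le> x" "x \<le> pi / 2"
  shows "x / 2 \<le> sin x"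
proof -
  define y where "y = x / 2"
  have y: "0 \<le> y" "y < pi / 2" using assms pi_gt_zero unfolding y_def by linarith+
  then have c: "cos y > 0" by (intro cos_gt_zero_pi) auto
  have "y \<le> \<bar>tan y\<bar>" using abs_tan_ge[of y] y by simp
  also have "\<bar>tan y\<bar> = sin y / cos y"
    using c y sin_ge_zero[of y] by (simp add: tan_def)
  finally have yc: "y * cos y \<le> sin y" using c by (simp add: field_simps)
  have "cos x \<ge> 0" using assms by (intro cos_ge_zero) auto
  moreover have "cos x = 2 * (cos y)\<^sup>2 - 1" unfolding y_def using cos_double_cos[of "x / 2"] by simp
  ultimately have "1 / 2 \<le> (cos y)\<^sup>2" by simp
  then have "y * (1 / 2) \<le> y * (cos y)\<^sup>2" using y by (intro mult_left_mono) auto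
  also have "\<dots> = (y * cos y) * cos y" by (simp add: power2_eq_square)
  also have "\<dots> \<le> sin y * cos y" using yc c by (intro mult_right_mono) auto
  also have "sin y * cos y = sin x / 2" unfolding y_def using sin_double[of "x / 2"] by simp
  finally show ?thesis by (simp add: y_def)
qed

lemma zroot_power: "zroot N ^ n = exp (\<i> * of_real (2 * pi * real n / real N))"
  unfolding zroot_def exp_of_nat_mult[symmetric] by (simp add: mult_ac)

lemma norm_one_minus_zroot_power:
  "norm (1 - zroot N ^ n) = 2 * \<bar>sin (pi * real n / real N)\<bar>"
  using dist_exp_i_1[of "2 * pi * real n / real N"]
  by (simp add: zroot_power norm_minus_commute)

lemma zroot_ne_1: "N > 1 \<Longrightarrow> zroot N \<noteq> 1"
proof
  assume N: "N > 1" and "zroot N = 1"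
  then have "sin (pi / real N) = 0" using norm_one_minus_zroot_power[of N 1] by simp
  moreover have "sin (pi / real N) > 0" using N by (intro sin_gt_zero) (auto simp: field_simps)
  ultimately show False by simp
qed

lemma zroot_power_self: "N > 0 \<Longrightarrow> zroot N ^ N = 1"
  by (simp add: zroot_power exp_eq_1)

text \<open>The norm is sin(pi n / N) / sin(pi / N). As n <= N/2, \<open>sin_ge_half\<close> bounds
  the numerator below, and sin x <= x bounds the denominator above.\<close>

lemma norm_qnum_zroot_ge:
  assumes "2 * n \<le> N" "N > 1"
  shows "norm (qnum (zroot N) n) \<ge> real n / 2"
proof -
  have N: "real N > 1" using assms by simp
  have s0: "sin (pi / real N) > 0" using N by (intro sin_gt_zero) (auto simp: field_simps)
  have s1: "sin (pi / real N) \<le> pi / real N" using N by (intro sin_x_le_x) auto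
  have eq: "norm (qnum (zroot N) n) = \<bar>sin (pi * real n / real N)\<bar> / \<bar>sin (pi / real N)\<bar>"
    using norm_one_minus_zroot_power[of N n] norm_one_minus_zroot_power[of N 1]
    by (simp add: qnum_eq_quotient[OF zroot_ne_1[OF assms(2)]] norm_divide)
  have "pi * real n / real N / 2 \<le> sin (pi * real n / real N)"
  proof (intro sin_ge_half)
    have "real n * 2 \<le> real N" using assms(1) by linarith
    then have "real n / real N \<le> 1 / 2" using N by (simp add: field_simps)
    then have "pi * (real n / real N) \<le> pi * (1 / 2)" by (intro mult_left_mono) auto
    then show "pi * real n / real N \<le> pi / 2" by simp
  qed (use N in auto)
  moreover have "real n / 2 * sin (pi / real N) \<le> real n / 2 * (pi / real N)"
    using s1 by (intro mult_left_mono) auto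
  moreover have "real n / 2 * (pi / real N) = pi * real n / real N / 2"
    by (simp add: mult.commute)
  ultimately have "real n / 2 * sin (pi / real N) \<le> \<bar>sin (pi * real n / real N)\<bar>" by linarith
  also have "\<dots> = norm (qnum (zroot N) n) * sin (pi / real N)" using s0 by (simp add: eq)
  finally have "real n / 2 * sin (pi / real N) \<le> norm (qnum (zroot N) n) * sin (pi / real N)" .
  then show ?thesis using s0 by simp
qed

lemma tendsto_zroot: "zroot \<longlonglongrightarrow> 1"
proof -
  have "(\<lambda>N. exp (2 * of_real pi * \<i> / of_nat N) :: complex) \<longlonglongrightarrow> exp 0"
    by (intro tendsto_exp lim_const_over_n)
  then show ?thesis by (simp add: zroot_def[abs_def])
qed

text \<open>The alternating series is the zeta series minus twice its terms at even integers, which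
  sum to zeta(w) / 2^w.\<close>

lemma alternating_zeta_sums:
  assumes "w \<ge> 2"
  shows "(\<lambda>n. (-1) ^ n / real (Suc n) ^ w) sums ((1 - 2 powi (1 - int w)) * zeta_nat w)"
proof -
  let ?f = "\<lambda>n. 1 / real (Suc n) ^ w"
  have "summable (\<lambda>n. inverse (real (Suc n) ^ w))"
    using inverse_power_summable[OF assms] by (subst summable_Suc_iff)
  then have f: "?f sums zeta_nat w"
    unfolding zeta_nat_def by (simp add: inverse_eq_divide summable_sums)
  have "(\<lambda>n. 2 / 2 ^ w * ?f n) sums (2 / 2 ^ w * zeta_nat w)"
    using f by (rule sums_mult)
  \<comment> \<open>As the series is indexed from 0, the even integers sit at the odd indices, where
    \<open>1 - (-1) ^ n\<close> is 2; at even indices it is 0, so the gaps can be filled in.\<close>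
  also have "(\<lambda>n. 2 / 2 ^ w * ?f n) = (\<lambda>n. (1 - (-1) ^ (2 * n + 1)) / real (Suc (2 * n + 1)) ^ w)"
    by (simp add: fun_eq_iff power_mult_distrib[symmetric] algebra_simps)
  finally have "(\<lambda>n. (1 - (-1) ^ n) / real (Suc n) ^ w) sums (2 / 2 ^ w * zeta_nat w)"
  proof (subst (asm) sums_mono_reindex)
    show "strict_mono (\<lambda>n::nat. 2 * n + 1)" by (simp add: strict_mono_def)
    show "(1 - (-1) ^ n) / real (Suc n) ^ w = 0" if "n \<notin> range (\<lambda>n. 2 * n + 1)" for n
    proof -
      have "even n" using that by (metis oddE rangeI)
      then show ?thesis by simp
    qed
  qed
  from sums_diff[OF f this]
  have "(\<lambda>n. (-1) ^ n / real (Suc n) ^ w) sums (zeta_nat w - 2 / 2 ^ w * zeta_nat w)"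
    by (simp add: diff_divide_distrib)
  moreover have "(2::real) powi (1 - int w) = 2 / 2 ^ w" by (simp add: power_int_diff)
  ultimately show ?thesis by (simp add: algebra_simps)
qed

text \<open>Tannery's theorem, applied after extending each finite sum by zeros to a series;
  \<open>norm_qnum_zroot_ge\<close> supplies the majorant 2^w / (k + 1)^w.\<close>

lemma tendsto_calE:
  assumes "w \<ge> 2"
  shows "(\<lambda>N. calE w N) \<longlonglongrightarrow> of_real ((1 - 2 powi (1 - int w)) * zeta_nat w)"
proof -
  define t where "t = (\<lambda>k N. (-1) ^ k * zroot N ^ (2 * Suc k) / qnum (zroot N) (Suc k) ^ w)"
  define a where "a = (\<lambda>k N. if Suc k \<le> (N - 1) div 2 then t k N else 0)"
  have calE: "calE w N = (\<Sum>k. a k N)" for N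
  proof -
    have "(\<Sum>k. a k N) = (\<Sum>k<(N - 1) div 2. a k N)"
      by (intro suminf_finite) (auto simp: a_def)
    also have "\<dots> = calE w N"
      unfolding calE_def qE_def a_def t_def
      by (rule sum.reindex_bij_witness[of _ "\<lambda>n. n - 1" Suc]) auto
    finally show ?thesis ..
  qed
  have lim: "(\<lambda>N. a k N) \<longlonglongrightarrow> (-1) ^ k / of_nat (Suc k) ^ w" for k
  proof -
    have q: "(\<lambda>N. qnum (zroot N) (Suc k)) \<longlonglongrightarrow> (\<Sum>i<Suc k. 1 ^ i)"
      unfolding qnum_def by (intro tendsto_sum tendsto_power tendsto_zroot)
    have "(\<lambda>N. t k N) \<longlonglongrightarrow> (-1) ^ k * 1 ^ (2 * Suc k) / (\<Sum>i<Suc k. 1 ^ i) ^ w"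
      unfolding t_def by (intro tendsto_intros tendsto_zroot q) (simp add: add_eq_0_iff_both_eq_0 del: of_nat_Suc)
    \<comment> \<open>From \<open>N = 2 * k + 3\<close> on, the term with index k lies within the
      summation range.\<close>
    moreover have "\<forall>\<^sub>F N in sequentially. t k N = a k N"
      using eventually_ge_at_top[of "2 * k + 3"] by eventually_elim (auto simp: a_def)
    ultimately show ?thesis by (simp add: filterlim_cong)
  qed
  have bound: "norm (a k N) \<le> 2 ^ w * inverse (real (Suc k) ^ w)" for k N
  proof (cases "Suc k \<le> (N - 1) div 2")
    case True
    then have "real (Suc k) / 2 \<le> norm (qnum (zroot N) (Suc k))"
      by (intro norm_qnum_zroot_ge) auto
    then have "(real (Suc k) / 2) ^ w \<le> norm (qnum (zroot N) (Suc k)) ^ w"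
      by (intro power_mono) auto
    moreover have "norm (zroot N) = 1" by (simp add: zroot_def)
    ultimately have "norm (t k N) \<le> 1 / (real (Suc k) / 2) ^ w"
      unfolding t_def by (simp add: norm_mult norm_divide norm_power frac_le del: of_nat_Suc)
    then show ?thesis using True by (simp add: a_def power_divide field_simps)
  qed (auto simp: a_def)
  have "summable (\<lambda>k. 2 ^ w * inverse (real (Suc k) ^ w))"
    using inverse_power_summable[OF assms, where 'a = real]
    by (intro summable_mult) (subst summable_Suc_iff)
  then have "(\<lambda>N. \<Sum>k. a k N) \<longlonglongrightarrow> (\<Sum>k. (-1) ^ k / of_nat (Suc k) ^ w)"
    by (intro tannerys_theorem[where M = "\<lambda>k. 2 ^ w * inverse (real (Suc k) ^ w)",
          THEN conjunct2, THEN conjunct2] lim) (use bound in \<open>auto simp: case_prod_unfold simp del: of_nat_Suc\<close>)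
  moreover have "(\<lambda>k. (-1) ^ k / of_nat (Suc k) ^ w) sums
      (of_real ((1 - 2 powi (1 - int w)) * zeta_nat w) :: complex)"
    using sums_of_real[OF alternating_zeta_sums[OF assms], where 'a = complex] by simp
  ultimately show ?thesis by (simp add: calE sums_iff)
qed

section \<open>The algebraic limit\<close>

text \<open>Cosets multiply through representatives. With \<open>A_class_eq_iff\<close>, the
  identity in \<open>ringA\<close> becomes a congruence at all but finitely many primes.\<close>

lemma A_class_mult: "A_class f \<otimes>\<^bsub>ringA\<^esub> A_class g = A_class (\<lambda>p. f p * g p)"
proof -
  interpret I: ideal prime_sum prime_prod by (rule prime_sum_ideal)
  let ?r = "\<lambda>f::nat \<Rightarrow> int. \<lambda>p\<in>{p. prime p}. f p mod int p"
  have car: "?r f \<in> carrier prime_prod" for f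
    by (auto simp: prime_prod_def residue_ring_def prime_gt_0_nat)
  have "?r f \<otimes>\<^bsub>prime_prod\<^esub> ?r g = ?r (\<lambda>p. f p * g p)"
    by (auto simp: prime_prod_def residue_ring_def fun_eq_iff mod_simps)
  then show ?thesis
    using I.rcoset_mult_add[OF car car, of f g] by (simp add: ringA_def FactRing_def A_class_def)
qed

lemma prime_root_zroot: "prime p \<Longrightarrow> p \<ge> 3 \<Longrightarrow> prime_root p (zroot p)"
  using zroot_power_self[of p] zroot_ne_1[of p] prime_odd_nat[of p]
  by unfold_locales auto

theorem proposition5p1:
  fixes w :: nat
  assumes "w \<ge> 3" and "odd w"
  shows
    "(\<forall>p::nat. prime p \<and> p \<ge> 11 \<longrightarrow>
        (let r = (p + 1) div 4 in
           regular_at (fst (U w r r)) (zroot p) \<and>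
           regular_at (snd (U w r r)) (zroot p) \<and>
           value_at (snd (U w r r)) (zroot p) \<noteq> 0 \<and>
           value_at (fst (U w r r)) (zroot p) / value_at (snd (U w r r)) (zroot p)
             = qE w ((p - 1) div 2) (zroot p)))
     \<and> (\<forall>p::nat. prime p \<and> p > w \<longrightarrow>
          loc_cong (zroot p) (calE w p)
            (of_rat (1 - 2 powi (1 - int w)) * of_int (Zcomp w p)))
     \<and> A_class (\<lambda>p. loc_residue p (calE w p))
         = A_of_rat (1 - 2 powi (1 - int w)) \<otimes>\<^bsub>ringA\<^esub> Zw w
     \<and> ((\<lambda>N. calE w N) \<longlongrightarrow> of_real ((1 - 2 powi (1 - int w)) * zeta_nat w))
          (inf sequentially (principal {N. odd N}))"
proof (intro conjI allI impI)
  fix p :: nat assume p: "prime p \<and> p \<ge> 11"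
  then interpret prime_root p "zroot p" by (intro prime_root_zroot) auto
  define r where "r = (p + 1) div 4"
  have vals: "has_value (fst (U w r r)) (zroot p) (fst (Uval (zroot p) w r r))"
    "has_value (snd (U w r r)) (zroot p) (snd (Uval (zroot p) w r r))"
    using has_value_U[of r r w] by (auto simp: r_def)
  moreover have "snd (Uval (zroot p) w r r) \<noteq> 0" "fst (Uval (zroot p) w r r)
      = snd (Uval (zroot p) w r r) * qE w ((p - 1) div 2) (zroot p)"
    using Uval_top[of r w] p by (auto simp: r_def)
  ultimately show "let r = (p + 1) div 4 in
           regular_at (fst (U w r r)) (zroot p) \<and>
           regular_at (snd (U w r r)) (zroot p) \<and>
           value_at (snd (U w r r)) (zroot p) \<noteq> 0 \<and>
           value_at (fst (U w r r)) (zroot p) / value_at (snd (U w r r)) (zroot p)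
             = qE w ((p - 1) div 2) (zroot p)"
    unfolding Let_def r_def[symmetric] regular_at_def
    using value_at_eqI[OF vals(1)] value_at_eqI[OF vals(2)] by auto
next
  fix p :: nat assume p: "prime p \<and> p > w"
  then interpret prime_root p "zroot p" using assms by (intro prime_root_zroot) auto
  have "reduces_to (calE w p) ((1 - 2 ^ (p - w)) * Zcomp w p)"
    unfolding calE_def using assms p by (intro qE_reduces_to_Zcomp) auto
  moreover have "reduces_to (of_rat (1 - 2 powi (1 - int w)) * of_int (Zcomp w p))
      ((1 - 2 ^ (p - w)) * Zcomp w p)"
    using assms p by (intro reduces_to_mult reduces_to_of_rat_two_powi reduces_to_of_int) auto
  ultimately show "loc_cong (zroot p) (calE w p)
      (of_rat (1 - 2 powi (1 - int w)) * of_int (Zcomp w p))"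
    unfolding reduces_to_def using loc_cong_trans loc_cong_sym by blast
next
  \<comment> \<open>At primes above \<open>w\<close> both sides are congruent to
    \<open>(1 - 2 ^ (p - w)) * Zcomp w p\<close>; the exceptional primes are at most
    \<open>w\<close>.\<close>
  have "[loc_residue p (calE w p) = rat_mod p (1 - 2 powi (1 - int w)) * Zcomp w p] (mod int p)"
    if p: "prime p" "w < p" for p
  proof -
    interpret prime_root p "zroot p" using assms p by (intro prime_root_zroot) auto
    have "reduces_to (calE w p) ((1 - 2 ^ (p - w)) * Zcomp w p)"
      unfolding calE_def using assms p by (intro qE_reduces_to_Zcomp) auto
    then have "loc_residue p (calE w p) = ((1 - 2 ^ (p - w)) * Zcomp w p) mod int p"
      by (rule loc_residue_eqI[OF refl])
    moreover have "[rat_mod p (1 - 2 powi (1 - int w)) = 1 - 2 ^ (p - w)] (mod int p)"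
      using assms p by (intro rat_mod_eqI reduces_to_of_rat_two_powi) auto
    then have "[rat_mod p (1 - 2 powi (1 - int w)) * Zcomp w p = (1 - 2 ^ (p - w)) * Zcomp w p] (mod int p)"
      by (intro cong_mult cong_refl)
    ultimately show ?thesis by (simp add: cong_def)
  qed
  then have "finite {p. prime p \<and>
      \<not> [loc_residue p (calE w p) = rat_mod p (1 - 2 powi (1 - int w)) * Zcomp w p] (mod int p)}"
    by (intro finite_subset[OF _ finite_atMost[of w]]) (blast intro: leI)
  then show "A_class (\<lambda>p. loc_residue p (calE w p))
      = A_of_rat (1 - 2 powi (1 - int w)) \<otimes>\<^bsub>ringA\<^esub> Zw w"
    unfolding A_of_rat_def Zw_def A_class_mult A_class_eq_iff .
next
  show "((\<lambda>N. calE w N) \<longlongrightarrow> of_real ((1 - 2 powi (1 - int w)) * zeta_nat w))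
      (inf sequentially (principal {N. odd N}))"
    using assms by (intro tendsto_mono[OF inf_le1] tendsto_calE) auto
qed

end
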